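(* Let $q(\cdot)\in\mathcal{B}(\mathbb{R}^n)$, $0<\alpha<n\delta_2$ and $p\in(0,1]$, where $\delta_2$ is the constant attached to $q(\cdot)$. Let $T$ be a sublinear operator that is bounded on $WL^{q(\cdot)}(\mathbb{R}^n)$ and satisfies $$|Tf(x)|\le C|x|^{-n}\int_{\mathbb{R}^n}|f(y)|\,dy$$ for any $f\in L^1_{\rm loc}(\mathbb{R}^n)$ with $\operatorname{supp} f\subset B(0,r)$ and any $x\notin B(0,2r)$. Then $T$ maps $\dot K^{\alpha,p}_{q(\cdot)}(\mathbb{R}^n)$ continuously into $W\dot K^{\alpha,p}_{q(\cdot)}(\mathbb{R}^n)$, and likewise $T$ maps $K^{\alpha,p}_{q(\cdot)}(\mathbb{R}^n)$ continuously into $WK^{\alpha,p}_{q(\cdot)}(\mathbb{R}^n)$.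
   Context: For a measurable $q(\cdot):\mathbb{R}^n\to[1,\infty)$, $L^{q(\cdot)}(\mathbb{R}^n)$ is the set of measurable $f$ such that $\int(|f(x)|/\eta)^{q(x)}dx<\infty$ for some $\eta>0$, with norm $\|f\|_{L^{q(\cdot)}}=\inf\{\eta>0:\int_{\mathbb{R}^n}(|f(x)|/\eta)^{q(x)}dx\le1\}$; $L^{q(\cdot)}(F)$ is defined in the same way on $F$. For an open set $E$, $L^{q(\cdot)}_{\rm loc}(E)$ is the set of $f$ belonging to $L^{q(\cdot)}(F)$ for all compact $F\subset E$. $\mathcal{P}(\mathbb{R}^n)$ is the set of measurable $q(\cdot):\mathbb{R}^n\to[1,\infty)$ with $\operatorname{ess\,inf} q>1$ and $\operatorname{ess\,sup} q<\infty$; put $q'(x)=q(x)/(q(x)-1)$. $\mathcal{B}(\mathbb{R}^n)$ is the set of $q(\cdot)\in\mathcal{P}(\mathbb{R}^n)$ such that the Hardy–Littlewood maximal operator $Mf(x)=\sup_{B\ni x}|B|^{-1}\int_B|f|$ (supremum over balls $B$ containing $x$) is bounded on $L^{q(\cdot)}(\mathbb{R}^n)$. Constant $\delta_2$: for $q(\cdot)\in\mathcal{B}(\mathbb{R}^n)$ it is known that there are $\delta_2\in(0,1)$ depending on $q(\cdot)$ and $C>0$ such that $\|\chi_S\|_{L^{q'(\cdot)}}/\|\chi_B\|_{L^{q'(\cdot)}}\le C(|S|/|B|)^{\delta_2}$ for all balls $B\subset\mathbb{R}^n$ and all measurable $S\subset B$; $\delta_2$ denotes such a fixed constant. $B(0,r)=\{x\in\mathbb{R}^n:|x|<r\}$.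 For $k\in\mathbb{Z}$: $B_k=\{x\in\mathbb{R}^n:|x|\le2^k\}$, $A_k=B_k\setminus B_{k-1}$, $\chi_k=\chi_{A_k}$; $\tilde\chi_k=\chi_k$ for $k\ge1$ and $\tilde\chi_0=\chi_{B_0}$. Herz spaces: $\dot K^{\alpha,p}_{q(\cdot)}(\mathbb{R}^n)$ is the set of $f\in L^{q(\cdot)}_{\rm loc}(\mathbb{R}^n\setminus\{0\})$ with $\|f\|_{\dot K^{\alpha,p}_{q(\cdot)}}=\{\sum_{k=-\infty}^\infty2^{k\alpha p}\|f\chi_k\|^p_{L^{q(\cdot)}}\}^{1/p}<\infty$; $K^{\alpha,p}_{q(\cdot)}(\mathbb{R}^n)$ is the set of $f\in L^{q(\cdot)}_{\rm loc}(\mathbb{R}^n)$ with $\|f\|_{K^{\alpha,p}_{q(\cdot)}}=\{\sum_{k=0}^\infty2^{k\alpha p}\|f\tilde\chi_k\|^p_{L^{q(\cdot)}}\}^{1/p}<\infty$. Weak Herz spaces: $W\dot K^{\alpha,p}_{q(\cdot)}(\mathbb{R}^n)$ is the set of measurable $f$ with $$\|f\|_{W\dot K^{\alpha,p}_{q(\cdot)}}=\sup_{\lambda>0}\lambda\Big\{\sum_{k=-\infty}^\infty2^{k\alpha p}\|\chi_{\{x\in A_k:|f(x)|>\lambda\}}\|^p_{L^{q(\cdot)}}\Big\}^{1/p}<\infty;$$ $WK^{\alpha,p}_{q(\cdot)}(\mathbb{R}^n)$ is the set of measurable $f$ for which the analogous quantity $\|f\|_{WK^{\alpha,p}_{q(\cdot)}}$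 is finite, where the sum runs over $k\ge0$ and, in the term $k=0$, $A_0$ is replaced by $B(0,1)$. Weak Lebesgue space: $WL^{q(\cdot)}(\mathbb{R}^n)$ is the set of measurable $f$ with $\|f\|_{WL^{q(\cdot)}}=\sup_{\lambda>0}\lambda\|\chi_{\{x\in\mathbb{R}^n:|f(x)|>\lambda\}}\|_{L^{q(\cdot)}}<\infty$. "$T$ maps $X$ continuously into $Y$" means there is a constant $C$ with $\|Tf\|_Y\le C\|f\|_X$ for all $f\in X$. *)

theory Defs
  imports "HOL-Analysis.Analysis" "HOL-Probability.Essential_Supremum"
begin

section \<open>Variable exponent Lebesgue spaces\<close>

text \<open>
  All norms below take values in \<open>[0, \<infinity>]\<close>, so that ``belongs to the space'' and ``the norm is
  finite'' can be expressed without conventions about infima of empty sets (\<open>Inf {} = \<infinity>\<close>) or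
  divergent series.  The real power is extended to \<open>[0, \<infinity>]\<close> by \<open>\<infinity>\<^sup>a = \<infinity>\<close>, which is the right
  convention for \<open>a > 0\<close>, the only exponents that matter.
\<close>

definition epowr :: "ennreal \<Rightarrow> real \<Rightarrow> ennreal" where
  "epowr x a = (if x = \<infinity> then \<infinity> else ennreal (enn2real x powr a))"

definition ennorm :: "('a \<Rightarrow> 'b::real_normed_vector) \<Rightarrow> 'a \<Rightarrow> ennreal" where
  "ennorm f = (\<lambda>x. ennreal (norm (f x)))"

text \<open>
  The modular and the Luxemburg norm are defined on \<open>[0, \<infinity>]\<close>-valued functions, because they are
  also applied to maximal functions; for a scalar function \<open>f\<close> they are applied to \<open>\<bar>f\<bar>\<close>.
\<close>

definition modular :: "'a measure \<Rightarrow> ('a \<Rightarrow> real) \<Rightarrow> ('a \<Rightarrow> ennreal) \<Rightarrow> real \<Rightarrow> ennreal" where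
  "modular M q g \<eta> = (\<integral>\<^sup>+ x. epowr (g x / ennreal \<eta>) (q x) \<partial>M)"

definition lux_norm :: "'a measure \<Rightarrow> ('a \<Rightarrow> real) \<Rightarrow> ('a \<Rightarrow> ennreal) \<Rightarrow> ennreal" where
  "lux_norm M q g = (INF \<eta>\<in>{\<eta>. 0 < \<eta> \<and> modular M q g \<eta> \<le> 1}. ennreal \<eta>)"

definition Lq :: "'a measure \<Rightarrow> ('a \<Rightarrow> real) \<Rightarrow> ('a \<Rightarrow> 'b::real_normed_vector) set" where
  "Lq M q = {f \<in> borel_measurable M. \<exists>\<eta>>0. modular M q (ennorm f) \<eta> < \<infinity>}"

abbreviation Lq_norm :: "(real^'n \<Rightarrow> real) \<Rightarrow> (real^'n \<Rightarrow> 'b::real_normed_vector) \<Rightarrow> ennreal" where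
  "Lq_norm q f \<equiv> lux_norm lebesgue q (ennorm f)"

definition Lq_loc :: "(real^'n) set \<Rightarrow> (real^'n \<Rightarrow> real) \<Rightarrow> (real^'n \<Rightarrow> 'b::real_normed_vector) set" where
  "Lq_loc E q = {f. \<forall>F. compact F \<and> F \<subseteq> E \<longrightarrow> f \<in> Lq (lebesgue_on F) q}"

abbreviation L1_loc :: "(real^'n \<Rightarrow> 'b::real_normed_vector) set" where
  "L1_loc \<equiv> Lq_loc UNIV (\<lambda>_. 1)"

definition WLq_norm :: "(real^'n \<Rightarrow> real) \<Rightarrow> (real^'n \<Rightarrow> 'b::real_normed_vector) \<Rightarrow> ennreal" where
  "WLq_norm q f = (SUP t\<in>{0<..}. ennreal t * Lq_norm q (indicat_real {x. norm (f x) > t}))"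

definition WLq :: "(real^'n \<Rightarrow> real) \<Rightarrow> (real^'n \<Rightarrow> 'b::real_normed_vector) set" where
  "WLq q = {f \<in> borel_measurable lebesgue. WLq_norm q f < \<infinity>}"

section \<open>Classes of exponents\<close>

text \<open>The counterpart of the library's \<^const>\<open>esssup\<close>, for measurable functions.\<close>

definition essinf :: "'a measure \<Rightarrow> ('a \<Rightarrow> ereal) \<Rightarrow> ereal" where
  "essinf M f = Liminf (ae_filter M) f"

definition exponents_P :: "(real^'n \<Rightarrow> real) set" where
  "exponents_P = {q \<in> borel_measurable lebesgue. (\<forall>x. 1 \<le> q x) \<and>
     1 < essinf lebesgue (\<lambda>x. ereal (q x)) \<and> esssup lebesgue (\<lambda>x. ereal (q x)) < \<infinity>}"

text \<open>
  For \<open>q\<close> in the class above, \<open>q x = 1\<close> is possible only on a null set; the junk value \<open>1 / 0 = 0\<close>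
  taken there does not influence any modular.
\<close>

definition conj_exp :: "('a \<Rightarrow> real) \<Rightarrow> 'a \<Rightarrow> real" where
  "conj_exp q = (\<lambda>x. q x / (q x - 1))"

definition HL_maximal :: "(real^'n \<Rightarrow> real) \<Rightarrow> real^'n \<Rightarrow> ennreal" where
  "HL_maximal f x = (SUP B\<in>{ball c r | c r. 0 < r \<and> x \<in> ball c r}.
     (\<integral>\<^sup>+ y\<in>B. ennreal \<bar>f y\<bar> \<partial>lebesgue) / emeasure lebesgue B)"

definition exponents_B :: "(real^'n \<Rightarrow> real) set" where
  "exponents_B = {q \<in> exponents_P. \<exists>C::real. \<forall>f \<in> Lq lebesgue q.
     lux_norm lebesgue q (HL_maximal f) \<le> ennreal C * Lq_norm q f}"

definition is_delta2 :: "(real^'n \<Rightarrow> real) \<Rightarrow> real \<Rightarrow> bool" where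
  "is_delta2 q \<delta> \<longleftrightarrow> 0 < \<delta> \<and> \<delta> < 1 \<and>
     (\<exists>C>0. \<forall>c r S. 0 < r \<and> S \<in> sets lebesgue \<and> S \<subseteq> ball c r \<longrightarrow>
        Lq_norm (conj_exp q) (indicat_real S) / Lq_norm (conj_exp q) (indicat_real (ball c r))
          \<le> ennreal C * epowr (emeasure lebesgue S / emeasure lebesgue (ball c r)) \<delta>)"

section \<open>Herz spaces and weak Herz spaces\<close>

definition dyadic_ball :: "int \<Rightarrow> (real^'n) set" where
  "dyadic_ball k = {x. norm x \<le> 2 powi k}"

definition dyadic_annulus :: "int \<Rightarrow> (real^'n) set" where
  "dyadic_annulus k = dyadic_ball k - dyadic_ball (k - 1)"

definition restr :: "'a set \<Rightarrow> ('a \<Rightarrow> 'b::real_normed_vector) \<Rightarrow> 'a \<Rightarrow> 'b" where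
  "restr A f = (\<lambda>x. indicat_real A x *\<^sub>R f x)"

definition hom_Herz_norm ::
    "real \<Rightarrow> real \<Rightarrow> (real^'n \<Rightarrow> real) \<Rightarrow> (real^'n \<Rightarrow> 'b::real_normed_vector) \<Rightarrow> ennreal" where
  "hom_Herz_norm \<alpha> p q f =
     epowr (\<Sum>\<^sub>\<infinity>k::int. ennreal (2 powr (of_int k * \<alpha> * p)) *
              epowr (Lq_norm q (restr (dyadic_annulus k) f)) p) (1 / p)"

definition hom_Herz ::
    "real \<Rightarrow> real \<Rightarrow> (real^'n \<Rightarrow> real) \<Rightarrow> (real^'n \<Rightarrow> 'b::real_normed_vector) set" where
  "hom_Herz \<alpha> p q = {f \<in> Lq_loc (- {0}) q. hom_Herz_norm \<alpha> p q f < \<infinity>}"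

definition Herz_norm ::
    "real \<Rightarrow> real \<Rightarrow> (real^'n \<Rightarrow> real) \<Rightarrow> (real^'n \<Rightarrow> 'b::real_normed_vector) \<Rightarrow> ennreal" where
  "Herz_norm \<alpha> p q f =
     epowr (\<Sum>\<^sub>\<infinity>k::nat. ennreal (2 powr (of_nat k * \<alpha> * p)) *
              epowr (Lq_norm q (restr (if k = 0 then dyadic_ball 0 else dyadic_annulus (int k)) f)) p)
           (1 / p)"

definition Herz ::
    "real \<Rightarrow> real \<Rightarrow> (real^'n \<Rightarrow> real) \<Rightarrow> (real^'n \<Rightarrow> 'b::real_normed_vector) set" where
  "Herz \<alpha> p q = {f \<in> Lq_loc UNIV q. Herz_norm \<alpha> p q f < \<infinity>}"

definition weak_hom_Herz_norm ::
    "real \<Rightarrow> real \<Rightarrow> (real^'n \<Rightarrow> real) \<Rightarrow> (real^'n \<Rightarrow> 'b::real_normed_vector) \<Rightarrow> ennreal" where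
  "weak_hom_Herz_norm \<alpha> p q f =
     (SUP t\<in>{0<..}. ennreal t *
        epowr (\<Sum>\<^sub>\<infinity>k::int. ennreal (2 powr (of_int k * \<alpha> * p)) *
                 epowr (Lq_norm q (indicat_real {x \<in> dyadic_annulus k. norm (f x) > t})) p) (1 / p))"

definition weak_hom_Herz ::
    "real \<Rightarrow> real \<Rightarrow> (real^'n \<Rightarrow> real) \<Rightarrow> (real^'n \<Rightarrow> 'b::real_normed_vector) set" where
  "weak_hom_Herz \<alpha> p q = {f \<in> borel_measurable lebesgue. weak_hom_Herz_norm \<alpha> p q f < \<infinity>}"

definition weak_Herz_norm ::
    "real \<Rightarrow> real \<Rightarrow> (real^'n \<Rightarrow> real) \<Rightarrow> (real^'n \<Rightarrow> 'b::real_normed_vector) \<Rightarrow> ennreal" where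
  "weak_Herz_norm \<alpha> p q f =
     (SUP t\<in>{0<..}. ennreal t *
        epowr (\<Sum>\<^sub>\<infinity>k::nat. ennreal (2 powr (of_nat k * \<alpha> * p)) *
                 epowr (Lq_norm q (indicat_real
                   {x \<in> (if k = 0 then ball 0 1 else dyadic_annulus (int k)). norm (f x) > t})) p)
              (1 / p))"

definition weak_Herz ::
    "real \<Rightarrow> real \<Rightarrow> (real^'n \<Rightarrow> real) \<Rightarrow> (real^'n \<Rightarrow> 'b::real_normed_vector) set" where
  "weak_Herz \<alpha> p q = {f \<in> borel_measurable lebesgue. weak_Herz_norm \<alpha> p q f < \<infinity>}"

section \<open>Operators\<close>

text \<open>
  An operator is a map \<open>T\<close> together with its domain \<open>D\<close>, a linear space of measurable functions;
  values of \<open>T\<close> outside \<open>D\<close> are irrelevant.  The scalars are the elements of the type \<open>'b\<close>, which in the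
  class used here is (up to isomorphism) the field of real or of complex numbers.  Functions that
  agree almost everywhere are identified in the mathematics, so pointwise inequalities between
  functions are required almost everywhere.
\<close>

definition sublinear_op ::
    "(real^'n \<Rightarrow> 'b::{real_normed_field,euclidean_space}) set \<Rightarrow>
     ((real^'n \<Rightarrow> 'b) \<Rightarrow> real^'n \<Rightarrow> 'b) \<Rightarrow> bool" where
  "sublinear_op D T \<longleftrightarrow>
     D \<subseteq> borel_measurable lebesgue \<and>
     (\<lambda>_. 0) \<in> D \<and>
     (\<forall>f\<in>D. \<forall>g\<in>D. (\<lambda>x. f x + g x) \<in> D) \<and>
     (\<forall>c. \<forall>f\<in>D. (\<lambda>x. c * f x) \<in> D) \<and>
     (\<forall>f\<in>D. T f \<in> borel_measurable lebesgue) \<and>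
     (\<forall>f\<in>D. \<forall>g\<in>D. AE x in lebesgue. norm (T (\<lambda>x. f x + g x) x) \<le> norm (T f x) + norm (T g x)) \<and>
     (\<forall>c. \<forall>f\<in>D. AE x in lebesgue. norm (T (\<lambda>x. c * f x) x) = norm c * norm (T f x))"

definition maps_continuously ::
    "('a \<Rightarrow> 'b) set \<Rightarrow> (('a \<Rightarrow> 'b) \<Rightarrow> 'a \<Rightarrow> 'b) \<Rightarrow>
     ('a \<Rightarrow> 'b) set \<Rightarrow> (('a \<Rightarrow> 'b) \<Rightarrow> ennreal) \<Rightarrow>
     ('a \<Rightarrow> 'b) set \<Rightarrow> (('a \<Rightarrow> 'b) \<Rightarrow> ennreal) \<Rightarrow> bool" where
  "maps_continuously D T X norm_X Y norm_Y \<longleftrightarrow>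
     X \<subseteq> D \<and> (\<exists>C::real. \<forall>f\<in>X. T f \<in> Y \<and> norm_Y (T f) \<le> ennreal C * norm_X f)"

definition size_condition ::
    "(real^'n \<Rightarrow> 'b::real_normed_vector) set \<Rightarrow> ((real^'n \<Rightarrow> 'b) \<Rightarrow> real^'n \<Rightarrow> 'b) \<Rightarrow> bool" where
  "size_condition D T \<longleftrightarrow> (\<exists>C::real. \<forall>r>0. \<forall>f\<in>L1_loc. closure {x. f x \<noteq> 0} \<subseteq> ball 0 r \<longrightarrow>
     f \<in> D \<and>
     (AE x in lebesgue. x \<notin> ball 0 (2 * r) \<longrightarrow>
        ennreal (norm (T f x)) \<le>
          ennreal (C / norm x ^ CARD('n)) * (\<integral>\<^sup>+ y. ennreal (norm (f y)) \<partial>lebesgue)))"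

end

theory Submission
  imports Defs
begin

text \<open>
  Fix \<open>f\<close> in the homogeneous Herz space and write \<open>a\<^sub>j\<close> for the norm of its restriction to the annulus
  \<open>A\<^sub>j\<close>.  On a given annulus \<open>A\<^sub>k\<close>, split \<open>f\<close> into the part inside the ball \<open>B\<^sub>k\<^sub>-\<^sub>3\<close> and the rest.  The image of
  the outer part is controlled by the boundedness of the operator on the weak Lebesgue space, which gives the bound
  \<open>\<Sum>j\<ge>k-2. a\<^sub>j\<close>.  The image of the inner part is controlled by the size condition: on \<open>A\<^sub>k\<close> it is at most
  a constant times \<open>2\<^sup>-\<^sup>k\<^sup>n\<close> times the integral of the inner part.  By Hoelder's inequality and the
  condition \<open>\<parallel>\<chi>\<^sub>B\<parallel> \<parallel>\<chi>\<^sub>B\<parallel>' \<le> C \<bar>B\<bar>\<close> for balls (\<open>lux_norm_ball_product_le\<close>, where the prime marks the norm of the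
  conjugate exponent), combined with the defining property of \<open>\<delta>\<^sub>2\<close>, the
  norm of this bound over \<open>A\<^sub>k\<close> is at most a constant times the sum of \<open>2 powr ((j - k) n \<delta>\<^sub>2) a\<^sub>j\<close> over
  \<open>j \<le> k - 3\<close>.

  Both bounds are sums of shifted copies of the sequence \<open>a\<close>.  Since \<open>p \<le> 1\<close>, the \<open>p\<close>-th power of such a sum is at most the
  sum of the \<open>p\<close>-th powers, and interchanging the order of summation gives a geometric series
  (\<open>herz_sum_shift_sum\<close>).  It has ratio \<open>2 powr (- \<alpha> p)\<close> for the outer part and \<open>2 powr ((\<alpha> - n \<delta>\<^sub>2) p)\<close>
  for the inner part, so it converges because \<open>0 < \<alpha> < n \<delta>\<^sub>2\<close>.  The same finiteness shows that the inner part
  is integrable and that the outer part belongs to the Lebesgue space, so both lie in the domain of the operator.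

  For the inhomogeneous space, \<open>\<alpha> > 0\<close> implies that its quasi-norm dominates both the homogeneous one and the
  norm of the whole function in the variable exponent Lebesgue space.  The former takes care of the annuli \<open>A\<^sub>k\<close> with
  \<open>k \<ge> 1\<close>, the latter of the unit ball through the weak Lebesgue bound.
\<close>

section \<open>Powers and series in the extended half-line\<close>

lemma epowr_ennreal: "0 \<le> x \<Longrightarrow> epowr (ennreal x) a = ennreal (x powr a)"
  by (simp add: epowr_def)

lemma epowr_top [simp]: "epowr top a = top"
  by (simp add: epowr_def)

lemma epowr_0 [simp]: "epowr 0 a = 0"
  by (simp add: epowr_def)

lemma epowr_one [simp]: "epowr x 1 = x"
  by (cases x) (simp_all add: epowr_ennreal)

lemma epowr_mono: "x \<le> y \<Longrightarrow> 0 \<le> a \<Longrightarrow> epowr x a \<le> epowr y a"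
  by (cases x; cases y) (auto simp: epowr_ennreal powr_mono2 ennreal_leI top_unique)

lemma epowr_mult: "0 < a \<Longrightarrow> epowr (x * y) a = epowr x a * epowr y a"
proof (cases "x = top \<or> y = top")
  case True
  then show "0 < a \<Longrightarrow> ?thesis"
    by (cases "x = 0 \<or> y = 0")
      (auto simp: ennreal_top_mult ennreal_mult_top epowr_def ennreal_zero_less_mult_iff enn2real_eq_0_iff)
next
  case False
  then show "0 < a \<Longrightarrow> ?thesis"
    by (cases x; cases y) (auto simp: epowr_ennreal powr_mult simp flip: ennreal_mult)
qed

lemma epowr_epowr: "epowr (epowr x a) b = epowr x (a * b)"
  by (cases x) (simp_all add: epowr_ennreal powr_powr)

lemma epowr_less_top_iff [simp]: "epowr x a < top \<longleftrightarrow> x < top"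
  by (cases x) (simp_all add: epowr_ennreal)

lemma borel_measurable_epowr [measurable]:
  assumes [measurable]: "g \<in> borel_measurable M" "q \<in> borel_measurable M"
  shows "(\<lambda>x. epowr (g x) (q x)) \<in> borel_measurable M"
  unfolding epowr_def by measurable

text \<open>
  The power \<open>p \<le> 1\<close> is subadditive: if \<open>P\<close> is the sum of the \<open>p\<close>-th powers, each term is at most
  \<open>P\<close> to the \<open>1/p\<close>, so \<open>a\<close> is bounded by \<open>a\<close> to the \<open>p\<close> times a fixed power of \<open>P\<close>, and
  this can be summed.
\<close>
lemma epowr_suminf_le:
  fixes a :: "nat \<Rightarrow> ennreal"
  assumes p: "0 < p" "p \<le> 1"
  shows "epowr (\<Sum>n. a n) p \<le> (\<Sum>n. epowr (a n) p)"
proof -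
  define P where "P = (\<Sum>n. epowr (a n) p)"
  have le: "epowr (a n) p \<le> P" for n
    unfolding P_def using sum_le_suminf[of "\<lambda>n. epowr (a n) p" "{n}"] by simp
  have "a n \<le> epowr (a n) p * epowr P ((1 - p) / p)" for n
  proof -
    have "a n = epowr (a n) p * epowr (a n) (1 - p)"
      using p by (cases "a n") (auto simp: epowr_ennreal simp flip: ennreal_mult powr_add)
    also have "epowr (a n) (1 - p) = epowr (epowr (a n) p) ((1 - p) / p)"
      using p by (simp add: epowr_epowr)
    also have "\<dots> \<le> epowr P ((1 - p) / p)"
      using p le by (intro epowr_mono) auto
    finally show ?thesis by (simp add: mult_left_mono)
  qed
  then have "(\<Sum>n. a n) \<le> (\<Sum>n. epowr (a n) p * epowr P ((1 - p) / p))"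
    by (intro suminf_le) auto
  also have "\<dots> = P * epowr P ((1 - p) / p)" by (simp add: P_def)
  also have "\<dots> = epowr P (1 / p)"
  proof -
    have "1 + (1 - p) / p = 1 / p" using p by (simp add: field_simps)
    then show ?thesis
      using p by (cases P) (auto simp: epowr_ennreal ennreal_top_mult powr_mult_base simp flip: ennreal_mult)
  qed
  finally have "epowr (\<Sum>n. a n) p \<le> epowr (epowr P (1 / p)) p"
    using p by (intro epowr_mono) auto
  then show ?thesis using p by (simp add: epowr_epowr P_def)
qed

lemma epowr_add_le:
  assumes p: "0 < p" "p \<le> 1"
  shows "epowr (a + b) p \<le> epowr a p + epowr b p"
proof -
  define c where "c n = (if n = 0 then a else if n = Suc 0 then b else 0)" for n :: nat
  have 1: "(\<Sum>n. F (c n)) = F a + F b" if "F 0 = 0" for F :: "ennreal \<Rightarrow> ennreal"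
    using suminf_finite[of "{0, Suc 0}" "\<lambda>n. F (c n)"] that by (simp add: c_def)
  show ?thesis
    using epowr_suminf_le[OF p, of c] 1[of "\<lambda>x. x"] 1[of "\<lambda>x. epowr x p"] by simp
qed

lemma infsum_le_iff_ennreal:
  fixes f :: "'i \<Rightarrow> ennreal"
  shows "infsum f A \<le> C \<longleftrightarrow> (\<forall>F. finite F \<longrightarrow> F \<subseteq> A \<longrightarrow> sum f F \<le> C)"
  by (subst nonneg_infsum_complete) (auto simp: SUP_le_iff)

lemma sum_le_infsum_ennreal:
  fixes f :: "'i \<Rightarrow> ennreal"
  shows "finite F \<Longrightarrow> F \<subseteq> A \<Longrightarrow> sum f F \<le> infsum f A"
  using infsum_le_iff_ennreal[of f A "infsum f A"] by simp

lemma infsum_cmult_le_ennreal: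
  fixes f :: "'i \<Rightarrow> ennreal"
  shows "infsum (\<lambda>k. c * f k) A \<le> c * infsum f A"
  unfolding infsum_le_iff_ennreal
  by (auto simp: sum_le_infsum_ennreal mult_left_mono simp flip: sum_distrib_left)

lemma infsum_add_le_ennreal:
  fixes f g :: "'i \<Rightarrow> ennreal"
  shows "infsum (\<lambda>k. f k + g k) A \<le> infsum f A + infsum g A"
  unfolding infsum_le_iff_ennreal
  by (auto simp: sum.distrib intro!: add_mono sum_le_infsum_ennreal)

section \<open>Weighted sums over dyadic scales\<close>

text \<open>
  The \<open>p\<close>-th power of the Herz quasi-norm as a functional of the sequence of norms over the dyadic
  annuli.  For \<open>p \<le> 1\<close> this power, unlike the quasi-norm itself, is subadditive.
\<close>
definition herz_sum :: "real \<Rightarrow> real \<Rightarrow> (int \<Rightarrow> ennreal) \<Rightarrow> ennreal" where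
  "herz_sum \<alpha> p a = (\<Sum>\<^sub>\<infinity>k. ennreal (2 powr (of_int k * \<alpha> * p)) * epowr (a k) p)"

lemma herz_sum_term_le: "ennreal (2 powr (of_int k * \<alpha> * p)) * epowr (a k) p \<le> herz_sum \<alpha> p a"
  unfolding herz_sum_def using sum_le_infsum_ennreal[of "{k}" UNIV] by simp

text \<open>
  A discrete Hardy inequality.  For \<open>p \<le> 1\<close> the power passes inside the series over \<open>n\<close>; after
  interchanging the two sums, the sum over \<open>k\<close> is a translate of the one for \<open>a\<close>, and
  a shift by \<open>s n\<close> costs exactly the factor by which the weight changes.
\<close>
lemma herz_sum_shift_sum:
  fixes a b :: "int \<Rightarrow> ennreal" and s :: "nat \<Rightarrow> int"
  assumes p: "0 < p" "p \<le> 1"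
    and b: "\<And>k. b k \<le> (\<Sum>n. ennreal (d n) * a (k + s n))"
    and d: "\<And>n. 0 \<le> d n"
  shows "herz_sum \<alpha> p b \<le> (\<Sum>n. ennreal ((d n * 2 powr (- of_int (s n) * \<alpha>)) powr p)) * herz_sum \<alpha> p a"
proof -
  let ?w = "\<lambda>n. ennreal ((d n * 2 powr (- of_int (s n) * \<alpha>)) powr p)"
  let ?u = "\<lambda>k. ennreal (2 powr (of_int k * \<alpha> * p)) * epowr (a k) p"
  have weighted: "ennreal (2 powr (of_int k * \<alpha> * p)) * epowr (b k) p \<le> (\<Sum>n. ?w n * ?u (k + s n))" for k
  proof -
    have "epowr (b k) p \<le> (\<Sum>n. epowr (ennreal (d n) * a (k + s n)) p)"
      using epowr_suminf_le[OF p] epowr_mono[OF b, of p] p by (meson less_imp_le order_trans)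
    also have "\<dots> = (\<Sum>n. ennreal (d n powr p) * epowr (a (k + s n)) p)"
      using p d by (simp add: epowr_mult epowr_ennreal)
    finally have "ennreal (2 powr (of_int k * \<alpha> * p)) * epowr (b k) p
        \<le> ennreal (2 powr (of_int k * \<alpha> * p)) * (\<Sum>n. ennreal (d n powr p) * epowr (a (k + s n)) p)"
      by (rule mult_left_mono) simp
    also have "\<dots> = (\<Sum>n. ?w n * ?u (k + s n))"
    proof -
      have "2 powr (of_int k * \<alpha> * p) * d n powr p
        = (d n * 2 powr (- of_int (s n) * \<alpha>)) powr p * 2 powr (of_int (k + s n) * \<alpha> * p)" for n
      proof -
        have "2 powr (of_int k * \<alpha> * p)
          = 2 powr (- of_int (s n) * \<alpha> * p) * (2::real) powr (of_int (k + s n) * \<alpha> * p)"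
          by (simp add: algebra_simps flip: powr_add)
        moreover have "(d n * 2 powr (- of_int (s n) * \<alpha>)) powr p
            = d n powr p * 2 powr (- of_int (s n) * \<alpha> * p)"
          using d[of n] by (simp add: powr_mult powr_powr)
        ultimately show ?thesis by simp
      qed
      then have "ennreal (2 powr (of_int k * \<alpha> * p)) * (ennreal (d n powr p) * epowr (a (k + s n)) p)
          = ?w n * ?u (k + s n)" for n
        by (simp flip: ennreal_mult mult.assoc)
      then show ?thesis by (simp flip: ennreal_suminf_cmult)
    qed
    finally show ?thesis .
  qed
  show ?thesis
    unfolding herz_sum_def[of \<alpha> p b] infsum_le_iff_ennreal
  proof safe
    fix F :: "int set" assume F: "finite F"
    have "(\<Sum>k\<in>F. ennreal (2 powr (of_int k * \<alpha> * p)) * epowr (b k) p)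
        \<le> (\<Sum>k\<in>F. \<Sum>n. ?w n * ?u (k + s n))"
      by (intro sum_mono weighted)
    also have "\<dots> = (\<Sum>n. \<Sum>k\<in>F. ?w n * ?u (k + s n))"
      by (rule suminf_sum[symmetric]) auto
    also have "\<dots> \<le> (\<Sum>n. ?w n * herz_sum \<alpha> p a)"
    proof (intro suminf_le)
      fix n
      have "(\<Sum>k\<in>F. ?u (k + s n)) = sum ?u ((\<lambda>k. k + s n) ` F)"
        by (subst sum.reindex) (auto simp: inj_on_def)
      also have "\<dots> \<le> herz_sum \<alpha> p a"
        unfolding herz_sum_def using F by (intro sum_le_infsum_ennreal) auto
      finally show "(\<Sum>k\<in>F. ?w n * ?u (k + s n)) \<le> ?w n * herz_sum \<alpha> p a"
        by (simp add: mult_left_mono flip: sum_distrib_left)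
    qed auto
    also have "\<dots> = (\<Sum>n. ?w n) * herz_sum \<alpha> p a" by simp
    finally show "(\<Sum>k\<in>F. ennreal (2 powr (of_int k * \<alpha> * p)) * epowr (b k) p)
        \<le> (\<Sum>n. ?w n) * herz_sum \<alpha> p a" .
  qed
qed

text \<open>
  The bound, on the annulus of index \<open>k\<close>, for the image of the part of \<open>f\<close> supported well inside it
  (indices at most \<open>k - 3\<close>) when \<open>a j\<close> is the norm over the \<open>j\<close>-th annulus: the weight is \<open>2 powr ((j - k) * \<sigma>)\<close>
  with \<open>j = k - 3 - n\<close>.
\<close>
definition inner_sum :: "real \<Rightarrow> (int \<Rightarrow> ennreal) \<Rightarrow> int \<Rightarrow> ennreal" where
  "inner_sum \<sigma> a k = (\<Sum>n. ennreal (2 powr (- (real n + 3) * \<sigma>)) * a (k - 3 - int n))"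

text \<open>
  The triangle inequality bound for a function supported in the annuli of index at least \<open>k - c\<close>.  The offset
  \<open>c = 2\<close> serves the part of \<open>f\<close> outside the ball of index \<open>k - 3\<close>; the offset \<open>c = 0\<close> compares the
  inhomogeneous quasi-norm with other norms.
\<close>
definition outer_sum :: "int \<Rightarrow> (int \<Rightarrow> ennreal) \<Rightarrow> int \<Rightarrow> ennreal" where
  "outer_sum c a k = (\<Sum>n. a (k - c + int n))"

lemma suminf_ennreal_powr_finite:
  assumes "r < 0" "\<And>n. f n = c * 2 powr (real n * r)" "0 \<le> c"
  obtains W where "0 \<le> W" "(\<Sum>n. ennreal (f n)) = ennreal W"
proof -
  have "f n = c * (2 powr r) ^ n" for n
    using assms(2) by (simp add: powr_powr mult.commute flip: powr_realpow)
  moreover have "summable (\<lambda>n. c * (2 powr r) ^ n)"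
    using assms(1) by (intro summable_mult summable_geometric) (auto simp: powr_less_one)
  ultimately have "(\<Sum>n. ennreal (f n)) = ennreal (\<Sum>n. c * (2 powr r) ^ n)" "0 \<le> (\<Sum>n. c * (2 powr r) ^ n)"
    using assms(3) by (auto intro!: suminf_ennreal2 suminf_nonneg)
  then show thesis using that by blast
qed

text \<open>
  The shifts \<open>s n\<close> go inwards, so the weight of the Herz sum grows like \<open>2 powr (n * \<alpha>)\<close> while the
  coefficients decay like \<open>2 powr (- n * \<sigma>)\<close>.  This is the point where \<open>\<alpha> < \<sigma>\<close> is used.
\<close>
lemma herz_sum_inner_sum:
  assumes p: "0 < p" "p \<le> 1" and \<sigma>: "\<alpha> < \<sigma>"
  obtains W where "0 \<le> W" "\<And>a. herz_sum \<alpha> p (inner_sum \<sigma> a) \<le> ennreal W * herz_sum \<alpha> p a"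
proof -
  define s :: "nat \<Rightarrow> int" where "s n = - 3 - int n" for n
  define d where "d n = 2 powr (- (real n + 3) * \<sigma>)" for n
  have "(\<alpha> - \<sigma>) * p < 0" using p \<sigma> by (simp add: mult_less_0_iff)
  moreover have "(d n * 2 powr (- of_int (s n) * \<alpha>)) powr p
      = 2 powr (3 * ((\<alpha> - \<sigma>) * p)) * 2 powr (real n * ((\<alpha> - \<sigma>) * p))" for n
    by (simp add: d_def s_def powr_powr algebra_simps flip: powr_add)
  ultimately obtain W where W: "0 \<le> W" "(\<Sum>n. ennreal ((d n * 2 powr (- of_int (s n) * \<alpha>)) powr p)) = ennreal W"
    by (rule suminf_ennreal_powr_finite) auto
  have "herz_sum \<alpha> p (inner_sum \<sigma> a) \<le> ennreal W * herz_sum \<alpha> p a" for a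
    unfolding W(2)[symmetric]
    by (rule herz_sum_shift_sum[OF p]) (auto simp: inner_sum_def d_def s_def algebra_simps)
  with W(1) that show thesis by blast
qed

text \<open>
  The shifts go outwards, so the weight alone supplies the geometric decay; this is where
  \<open>\<alpha> > 0\<close> is used.
\<close>
lemma herz_sum_outer_sum:
  assumes p: "0 < p" "p \<le> 1" and \<alpha>: "0 < \<alpha>"
  obtains W where "0 \<le> W" "\<And>a. herz_sum \<alpha> p (outer_sum c a) \<le> ennreal W * herz_sum \<alpha> p a"
proof -
  define s :: "nat \<Rightarrow> int" where "s n = - c + int n" for n
  have "- \<alpha> * p < 0" using p \<alpha> by simp
  moreover have "(1 * 2 powr (- of_int (s n) * \<alpha>)) powr p
      = 2 powr (of_int c * \<alpha> * p) * 2 powr (real n * (- \<alpha> * p))" for n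
    by (simp add: s_def powr_powr algebra_simps flip: powr_add)
  ultimately obtain W where W: "0 \<le> W" "(\<Sum>n. ennreal ((1 * 2 powr (- of_int (s n) * \<alpha>)) powr p)) = ennreal W"
    by (rule suminf_ennreal_powr_finite) auto
  have "herz_sum \<alpha> p (outer_sum c a) \<le> ennreal W * herz_sum \<alpha> p a" for a
    unfolding W(2)[symmetric]
    by (rule herz_sum_shift_sum[OF p]) (auto simp: outer_sum_def s_def algebra_simps)
  with W(1) that show thesis by blast
qed

lemma herz_sum_finite_imp:
  assumes "0 < p" "herz_sum \<alpha> p a < top"
  shows "a k < top"
proof -
  have "ennreal (2 powr (of_int k * \<alpha> * p)) * epowr (a k) p < top"
    by (rule le_less_trans[OF herz_sum_term_le assms(2)])
  then have "epowr (a k) p < top"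
    by (cases "a k") (auto simp: ennreal_mult_less_top)
  then show ?thesis by simp
qed

lemma herz_sum_mono:
  assumes "0 < p" "\<And>k. a k \<le> b k" shows "herz_sum \<alpha> p a \<le> herz_sum \<alpha> p b"
  unfolding herz_sum_def using assms by (intro infsum_mono nonneg_summable_on_complete) (auto intro!: mult_left_mono epowr_mono)

lemma herz_sum_cmult_le:
  assumes "0 < p"
  shows "herz_sum \<alpha> p (\<lambda>k. c * a k) \<le> epowr c p * herz_sum \<alpha> p a"
  unfolding herz_sum_def epowr_mult[OF assms]
  using infsum_cmult_le_ennreal[of "epowr c p"] by (simp add: mult.left_commute)

lemma herz_sum_add_le:
  assumes p: "0 < p" "p \<le> 1"
  shows "herz_sum \<alpha> p (\<lambda>k. a k + b k) \<le> herz_sum \<alpha> p a + herz_sum \<alpha> p b"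
proof -
  have "herz_sum \<alpha> p (\<lambda>k. a k + b k) \<le> (\<Sum>\<^sub>\<infinity>k. ennreal (2 powr (of_int k * \<alpha> * p)) * epowr (a k) p
      + ennreal (2 powr (of_int k * \<alpha> * p)) * epowr (b k) p)"
    unfolding herz_sum_def
    by (intro infsum_mono nonneg_summable_on_complete) (auto simp flip: distrib_left intro!: mult_left_mono epowr_add_le p)
  also have "\<dots> \<le> herz_sum \<alpha> p a + herz_sum \<alpha> p b" unfolding herz_sum_def by (rule infsum_add_le_ennreal)
  finally show ?thesis .
qed

lemma mult_epowr_root:
  assumes "0 < p" shows "ennreal t * epowr X (1 / p) = epowr (epowr (ennreal t) p * X) (1 / p)"
  using assms by (simp add: epowr_mult epowr_epowr)

lemma epowr_le_root:
  assumes p: "0 < p" and K: "0 \<le> K" and "X \<le> ennreal K * Y"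
  shows "epowr X (1 / p) \<le> ennreal (K powr (1 / p)) * epowr Y (1 / p)"
  using epowr_mono[OF assms(3), of "1 / p"] p K by (simp add: epowr_mult epowr_ennreal)

lemma cmult_infsum_le_ennreal:
  fixes f :: "'i \<Rightarrow> ennreal"
  assumes "0 < t"
  shows "ennreal t * infsum f A \<le> infsum (\<lambda>k. ennreal t * f k) A"
proof -
  have "infsum f A = infsum (\<lambda>k. ennreal (1 / t) * (ennreal t * f k)) A"
    using assms by (simp flip: mult.assoc ennreal_mult)
  also have "\<dots> \<le> ennreal (1 / t) * infsum (\<lambda>k. ennreal t * f k) A" by (rule infsum_cmult_le_ennreal)
  finally have "ennreal t * infsum f A \<le> ennreal t * (ennreal (1 / t) * infsum (\<lambda>k. ennreal t * f k) A)"
    by (rule mult_left_mono) simp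
  then show ?thesis using assms by (simp flip: mult.assoc ennreal_mult)
qed

lemma epowr_mult_herz_sum_le:
  assumes "0 < t" "0 < p"
  shows "epowr (ennreal t) p * herz_sum \<alpha> p a \<le> herz_sum \<alpha> p (\<lambda>k. ennreal t * a k)"
  using cmult_infsum_le_ennreal[of "t powr p" "\<lambda>k. ennreal (2 powr (of_int k * \<alpha> * p)) * epowr (a k) p" UNIV] assms
  by (simp add: herz_sum_def epowr_mult epowr_ennreal mult.left_commute)

section \<open>The Luxemburg norm\<close>

lemma lux_norm_le: "0 < \<eta> \<Longrightarrow> modular M q g \<eta> \<le> 1 \<Longrightarrow> lux_norm M q g \<le> ennreal \<eta>"
  unfolding lux_norm_def by (rule INF_lower) simp

lemma lux_norm_obtain:
  assumes "lux_norm M q g < C"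
  obtains \<eta> where "0 < \<eta>" "modular M q g \<eta> \<le> 1" "ennreal \<eta> < C"
  using assms unfolding lux_norm_def INF_less_iff by auto

text \<open>
  For \<open>c > 0\<close> one divides by \<open>c\<close> and takes the infimum; for \<open>c = 0\<close> the finiteness of the norm supplies an
  admissible \<open>\<eta>\<close>.
\<close>
lemma le_mult_lux_norm:
  assumes "\<And>\<eta>. 0 < \<eta> \<Longrightarrow> modular M q g \<eta> \<le> 1 \<Longrightarrow> X \<le> c * ennreal \<eta>"
    and "c < top" and "lux_norm M q g < top"
  shows "X \<le> c * lux_norm M q g"
proof (cases "c = 0")
  case True
  then show ?thesis using assms(1) lux_norm_obtain[OF assms(3)] by auto
next
  case False
  have "X / c \<le> lux_norm M q g"
    unfolding lux_norm_def
  proof (rule INF_greatest)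
    fix \<eta> assume "\<eta> \<in> {\<eta>. 0 < \<eta> \<and> modular M q g \<eta> \<le> 1}"
    then have "X \<le> c * ennreal \<eta>" using assms(1) by auto
    then have "X / c \<le> c * ennreal \<eta> / c" by (rule divide_right_mono_ennreal)
    also have "\<dots> = ennreal \<eta>"
      using False assms(2) mult_divide_eq_ennreal[of c "ennreal \<eta>"] by (auto simp: mult.commute)
    finally show "X / c \<le> ennreal \<eta>" .
  qed
  then have "c * (X / c) \<le> c * lux_norm M q g" by (rule mult_left_mono) simp
  then show ?thesis
    using False assms(2) mult_divide_eq_ennreal[of c X] by (auto simp: ennreal_times_divide mult.commute)
qed

lemma modular_mono_AE:
  assumes "AE x in M. 0 \<le> q x" "AE x in M. g x / ennreal \<eta> \<le> h x / ennreal \<theta>"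
  shows "modular M q g \<eta> \<le> modular M q h \<theta>"
  unfolding modular_def
  by (rule nn_integral_mono_AE) (use assms in eventually_elim, auto intro: epowr_mono)

text \<open>
  Monotonicity and homogeneity in one statement.  With \<open>g\<close> an indicator function and \<open>h = \<bar>f\<bar>\<close> it is
  Chebyshev's inequality; with \<open>h\<close> a maximal function it turns averages over a ball into norm
  estimates.
\<close>
lemma cmult_lux_norm_le:
  assumes q: "AE x in M. 0 \<le> q x" and c: "0 < c"
    and le: "AE x in M. ennreal c * g x \<le> h x"
  shows "ennreal c * lux_norm M q g \<le> lux_norm M q h"
  unfolding lux_norm_def[of M q h]
proof (rule INF_greatest, safe)
  fix \<eta> :: real assume \<eta>: "0 < \<eta>" "modular M q h \<eta> \<le> 1"
  have "modular M q g (\<eta> / c) \<le> modular M q h \<eta>"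
  proof (rule modular_mono_AE[OF q], use le in eventually_elim)
    fix x assume "ennreal c * g x \<le> h x"
    then have "ennreal c * g x / ennreal \<eta> \<le> h x / ennreal \<eta>" by (rule divide_right_mono_ennreal)
    moreover have "ennreal c * g x / ennreal \<eta> = g x / ennreal (\<eta> / c)"
      using \<eta> c by (cases "g x")
        (auto simp: divide_ennreal ennreal_mult_top ennreal_top_divide field_simps simp flip: ennreal_mult)
    ultimately show "g x / ennreal (\<eta> / c) \<le> h x / ennreal \<eta>" by simp
  qed
  then have "lux_norm M q g \<le> ennreal (\<eta> / c)"
    using \<eta> c by (intro lux_norm_le) auto
  then have "ennreal c * lux_norm M q g \<le> ennreal c * ennreal (\<eta> / c)"
    by (rule mult_left_mono) simp
  also have "\<dots> = ennreal \<eta>" using \<eta> c by (simp flip: ennreal_mult)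
  finally show "ennreal c * lux_norm M q g \<le> ennreal \<eta>" .
qed

lemma lux_norm_mono_AE:
  "AE x in M. 0 \<le> q x \<Longrightarrow> AE x in M. g x \<le> h x \<Longrightarrow> lux_norm M q g \<le> lux_norm M q h"
  using cmult_lux_norm_le[where c = 1] by simp

lemma lux_norm_AE_zero:
  assumes "AE x in M. g x = 0"
  shows "lux_norm M q g = 0"
proof -
  have "modular M q g \<eta> = 0" for \<eta>
  proof -
    have "modular M q g \<eta> = (\<integral>\<^sup>+ x. 0 \<partial>M)"
      unfolding modular_def by (rule nn_integral_cong_AE) (use assms in eventually_elim, auto)
    then show ?thesis by simp
  qed
  then have "lux_norm M q g \<le> 0 + ennreal e" if "0 < e" for e :: real
    using lux_norm_le[of e M q g] that by simp
  then have "lux_norm M q g \<le> 0" by (rule ennreal_le_epsilon) auto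
  then show ?thesis by simp
qed

text \<open>
  This is where \<open>q \<ge> 1\<close> enters the triangle inequality: shrinking the argument by a factor at most one
  shrinks the modular at least by that factor.
\<close>
lemma epowr_rescale_le:
  assumes "0 < \<eta>" "\<eta> \<le> \<zeta>" "1 \<le> q"
  shows "epowr (g / ennreal \<zeta>) q \<le> ennreal (\<eta> / \<zeta>) * epowr (g / ennreal \<eta>) q"
proof -
  have "g / ennreal \<zeta> = ennreal (\<eta> / \<zeta>) * (g / ennreal \<eta>)"
    using assms by (cases g)
      (auto simp: divide_ennreal ennreal_mult_top ennreal_top_divide simp flip: ennreal_mult)
  then have "epowr (g / ennreal \<zeta>) q = ennreal ((\<eta> / \<zeta>) powr q) * epowr (g / ennreal \<eta>) q"
    using assms by (simp add: epowr_mult epowr_ennreal)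
  also have "(\<eta> / \<zeta>) powr q \<le> (\<eta> / \<zeta>) powr 1"
    using assms by (intro powr_mono') auto
  then have "ennreal ((\<eta> / \<zeta>) powr q) * epowr (g / ennreal \<eta>) q \<le> ennreal (\<eta> / \<zeta>) * epowr (g / ennreal \<eta>) q"
    using assms by (intro mult_right_mono ennreal_leI) auto
  finally show ?thesis .
qed

text \<open>
  A countable triangle inequality that asks only that \<open>h\<close> be dominated at each point by some \<open>g n\<close>; this
  is the form needed for functions cut into pieces and for unions of superlevel sets.  If \<open>\<eta> n\<close> is
  admissible for \<open>g n\<close> and \<open>\<zeta>\<close> is the sum of the \<open>\<eta> n\<close>, then the modular of \<open>h\<close> at \<open>\<zeta>\<close> is at
  most the convex combination of the modulars of the \<open>g n\<close> with weights \<open>\<eta> n / \<zeta>\<close>.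
\<close>
lemma lux_norm_le_suminf:
  fixes g :: "nat \<Rightarrow> 'a \<Rightarrow> ennreal"
  assumes q: "AE x in M. 1 \<le> q x"
    and meas [measurable]: "q \<in> borel_measurable M" "\<And>n. g n \<in> borel_measurable M"
    and cover: "AE x in M. \<exists>n. h x \<le> g n x"
  shows "lux_norm M q h \<le> (\<Sum>n. lux_norm M q (g n))"
proof (cases "(\<Sum>n. lux_norm M q (g n)) < top")
  case False
  then show ?thesis by (simp add: not_less top_unique)
next
  case True
  have fin: "lux_norm M q (g n) < top" for n
    using sum_le_suminf[of "\<lambda>n. lux_norm M q (g n)" "{n}"] True by (simp add: le_less_trans)
  show ?thesis
  proof (rule ennreal_le_epsilon)
    fix e :: real assume e: "0 < e"
    have "lux_norm M q (g n) < lux_norm M q (g n) + ennreal (e * (1/2) ^ Suc n)" for n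
      using fin[of n] e by (cases "lux_norm M q (g n)") (auto simp: ennreal_less_iff simp flip: ennreal_plus)
    then have "\<exists>\<eta>>0. modular M q (g n) \<eta> \<le> 1 \<and> ennreal \<eta> < lux_norm M q (g n) + ennreal (e * (1/2) ^ Suc n)" for n
      using lux_norm_obtain by metis
    then obtain \<eta> where \<eta>: "\<And>n. 0 < \<eta> n" "\<And>n. modular M q (g n) (\<eta> n) \<le> 1"
      "\<And>n. ennreal (\<eta> n) < lux_norm M q (g n) + ennreal (e * (1/2) ^ Suc n)"
      by metis
    have "(\<Sum>n. ennreal (\<eta> n)) \<le> (\<Sum>n. lux_norm M q (g n) + ennreal (e * (1/2) ^ Suc n))"
      using \<eta>(3) by (intro suminf_le) (auto intro: less_imp_le)
    also have "\<dots> = (\<Sum>n. lux_norm M q (g n)) + (\<Sum>n. ennreal (e * (1/2) ^ Suc n))"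
      by (rule suminf_add[symmetric]) auto
    also have "(\<Sum>n. ennreal (e * (1/2) ^ Suc n)) = ennreal e"
      using e sums_mult[OF power_half_series, of e] by (intro suminf_ennreal_eq) auto
    finally have le: "(\<Sum>n. ennreal (\<eta> n)) \<le> (\<Sum>n. lux_norm M q (g n)) + ennreal e" .
    also have "\<dots> < top" using True by simp
    finally obtain \<zeta> where \<zeta>: "0 \<le> \<zeta>" "(\<Sum>n. ennreal (\<eta> n)) = ennreal \<zeta>"
      by (cases "\<Sum>n. ennreal (\<eta> n)") auto
    have \<eta>\<zeta>: "\<eta> n \<le> \<zeta>" for n
      using sum_le_suminf[of "\<lambda>n. ennreal (\<eta> n)" "{n}"] \<zeta> by simp
    have \<zeta>0: "0 < \<zeta>" using \<eta>(1)[of 0] \<eta>\<zeta>[of 0] by simp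
    have "modular M q h \<zeta> \<le> (\<integral>\<^sup>+ x. (\<Sum>n. ennreal (\<eta> n / \<zeta>) * epowr (g n x / ennreal (\<eta> n)) (q x)) \<partial>M)"
      unfolding modular_def
    proof (rule nn_integral_mono_AE, use q cover in eventually_elim)
      fix x assume x: "1 \<le> q x" "\<exists>n. h x \<le> g n x"
      then obtain n where n: "h x \<le> g n x" by auto
      have "epowr (h x / ennreal \<zeta>) (q x) \<le> epowr (g n x / ennreal \<zeta>) (q x)"
        using x n by (intro epowr_mono divide_right_mono_ennreal) auto
      also have "\<dots> \<le> ennreal (\<eta> n / \<zeta>) * epowr (g n x / ennreal (\<eta> n)) (q x)"
        using x \<eta>(1) \<eta>\<zeta> by (intro epowr_rescale_le) auto
      also have "\<dots> \<le> (\<Sum>n. ennreal (\<eta> n / \<zeta>) * epowr (g n x / ennreal (\<eta> n)) (q x))"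
        using sum_le_suminf[of "\<lambda>n. ennreal (\<eta> n / \<zeta>) * epowr (g n x / ennreal (\<eta> n)) (q x)" "{n}"]
        by simp
      finally show "epowr (h x / ennreal \<zeta>) (q x)
          \<le> (\<Sum>n. ennreal (\<eta> n / \<zeta>) * epowr (g n x / ennreal (\<eta> n)) (q x))" .
    qed
    also have "\<dots> = (\<Sum>n. ennreal (\<eta> n / \<zeta>) * modular M q (g n) (\<eta> n))"
      unfolding modular_def by (subst nn_integral_suminf) (simp_all add: nn_integral_cmult)
    also have "\<dots> \<le> (\<Sum>n. ennreal (\<eta> n) / ennreal \<zeta>)"
    proof (intro suminf_le)
      fix n
      have "ennreal (\<eta> n / \<zeta>) * modular M q (g n) (\<eta> n) \<le> ennreal (\<eta> n / \<zeta>) * 1"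
        using \<eta>(2) by (intro mult_left_mono) auto
      then show "ennreal (\<eta> n / \<zeta>) * modular M q (g n) (\<eta> n) \<le> ennreal (\<eta> n) / ennreal \<zeta>"
        using \<eta>(1)[of n] \<zeta>0 by (simp add: divide_ennreal)
    qed auto
    also have "\<dots> = ennreal \<zeta> / ennreal \<zeta>"
      using \<zeta> by (simp add: divide_ennreal_def)
    also have "\<dots> = 1" using \<zeta>0 by (simp add: divide_ennreal)
    finally have "lux_norm M q h \<le> ennreal \<zeta>" using \<zeta>0 by (intro lux_norm_le)
    then show "lux_norm M q h \<le> (\<Sum>n. lux_norm M q (g n)) + ennreal e"
      using le \<zeta> by simp
  qed
qed

lemma lux_norm_le_add:
  assumes q: "AE x in M. 1 \<le> q x"
    and [measurable]: "q \<in> borel_measurable M" "g \<in> borel_measurable M" "g' \<in> borel_measurable M"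
    and cover: "AE x in M. h x \<le> g x \<or> h x \<le> g' x"
  shows "lux_norm M q h \<le> lux_norm M q g + lux_norm M q g'"
proof -
  define G where "G n = (if n = 0 then g else if n = Suc 0 then g' else (\<lambda>_. 0))" for n :: nat
  have [measurable]: "G n \<in> borel_measurable M" for n unfolding G_def by auto
  have "AE x in M. \<exists>n. h x \<le> G n x"
    using cover by eventually_elim (auto simp: G_def intro: exI[of _ 0] exI[of _ "Suc 0"])
  then have "lux_norm M q h \<le> (\<Sum>n. lux_norm M q (G n))"
    by (intro lux_norm_le_suminf[OF q]) auto
  also have "\<dots> = (\<Sum>n\<in>{0, Suc 0}. lux_norm M q (G n))"
    by (rule suminf_finite) (auto simp: G_def lux_norm_AE_zero)
  finally show ?thesis by (simp add: G_def)
qed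

lemma Young_epowr:
  assumes "1 < q"
  shows "a * b \<le> epowr a q + epowr b (q / (q - 1))"
proof (cases "a = top \<or> b = top")
  case True then show ?thesis by auto
next
  case False
  then obtain s t where st: "a = ennreal s" "b = ennreal t" "0 \<le> s" "0 \<le> t"
    by (cases a; cases b) auto
  have q': "1 < q / (q - 1)" "1 / q + 1 / (q / (q - 1)) = 1"
    using assms by (auto simp: field_simps)
  have "s * t \<le> s powr q / q + t powr (q / (q - 1)) / (q / (q - 1))"
    using Youngs_inequality[of q "q / (q - 1)" s t] assms q' st by auto
  also have "\<dots> \<le> s powr q + t powr (q / (q - 1))"
  proof (intro add_mono)
    have "x / r \<le> x" if "0 \<le> x" "1 < r" for x r :: real
      using that mult_left_mono[of 1 r x] by (simp add: field_simps)
    note le = this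
    show "s powr q / q \<le> s powr q" by (rule le) (use assms in auto)
    show "t powr (q / (q - 1)) / (q / (q - 1)) \<le> t powr (q / (q - 1))"
      by (rule le) (use q'(1) in auto)
  qed
  finally show ?thesis
    using st by (simp add: epowr_ennreal ennreal_leI flip: ennreal_mult ennreal_plus)
qed

text \<open>
  Hoelder's inequality with constant 2, by integrating Young's inequality for the normalised
  functions: each of the two modulars contributes at most 1.
\<close>
lemma nn_integral_mult_le_lux_norm:
  assumes q: "AE x in M. 1 < q x"
    and [measurable]: "q \<in> borel_measurable M" "g \<in> borel_measurable M" "h \<in> borel_measurable M"
    and fin: "lux_norm M q g < top" "lux_norm M (conj_exp q) h < top"
  shows "(\<integral>\<^sup>+ x. g x * h x \<partial>M) \<le> 2 * lux_norm M q g * lux_norm M (conj_exp q) h"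
proof (rule le_mult_lux_norm)
  fix \<zeta> :: real assume \<zeta>: "0 < \<zeta>" "modular M (conj_exp q) h \<zeta> \<le> 1"
  have "(\<integral>\<^sup>+ x. g x * h x \<partial>M) \<le> (2 * ennreal \<zeta>) * lux_norm M q g"
  proof (rule le_mult_lux_norm)
    fix \<eta> :: real assume \<eta>: "0 < \<eta>" "modular M q g \<eta> \<le> 1"
    have [measurable]: "conj_exp q \<in> borel_measurable M" unfolding conj_exp_def by measurable
    have "(\<integral>\<^sup>+ x. g x * h x \<partial>M) \<le> (\<integral>\<^sup>+ x. ennreal (\<eta> * \<zeta>) *
        (epowr (g x / ennreal \<eta>) (q x) + epowr (h x / ennreal \<zeta>) (conj_exp q x)) \<partial>M)"
    proof (rule nn_integral_mono_AE, use q in eventually_elim)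
      fix x assume x: "1 < q x"
      have eq: "c = ennreal e * (c / ennreal e)" if "0 < e" for c e
        using that by (simp add: ennreal_times_divide mult_divide_eq_ennreal mult.commute[of "ennreal e"])
      have "g x * h x = ennreal (\<eta> * \<zeta>) * ((g x / ennreal \<eta>) * (h x / ennreal \<zeta>))"
        using \<eta>(1) \<zeta>(1)
        by (subst eq[OF \<eta>(1), of "g x"], subst eq[OF \<zeta>(1), of "h x"]) (simp add: ennreal_mult mult_ac)
      also have "\<dots> \<le> ennreal (\<eta> * \<zeta>) *
          (epowr (g x / ennreal \<eta>) (q x) + epowr (h x / ennreal \<zeta>) (conj_exp q x))"
        unfolding conj_exp_def by (intro mult_left_mono Young_epowr x) auto
      finally show "g x * h x \<le> \<dots>" .
    qed
    also have "\<dots> = ennreal (\<eta> * \<zeta>) * (modular M q g \<eta> + modular M (conj_exp q) h \<zeta>)"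
      unfolding modular_def by (simp add: nn_integral_cmult nn_integral_add)
    also have "\<dots> \<le> ennreal (\<eta> * \<zeta>) * (1 + 1)"
      using \<eta> \<zeta> by (intro mult_left_mono add_mono) auto
    also have "\<dots> = 2 * ennreal \<zeta> * ennreal \<eta>"
      using \<eta> \<zeta> by (simp add: ennreal_mult mult_ac)
    finally show "(\<integral>\<^sup>+ x. g x * h x \<partial>M) \<le> 2 * ennreal \<zeta> * ennreal \<eta>" .
  qed (use fin in \<open>auto simp: ennreal_mult_less_top\<close>)
  then show "(\<integral>\<^sup>+ x. g x * h x \<partial>M) \<le> 2 * lux_norm M q g * ennreal \<zeta>" by (simp add: mult_ac)
qed (use fin in \<open>auto simp: ennreal_mult_less_top\<close>)

section \<open>Norms of indicator functions of balls\<close>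

lemma ennorm_indicat_real: "ennorm (indicat_real S) = indicator S"
  by (auto simp: ennorm_def indicator_def fun_eq_iff)

lemma exponents_P_AE_bounded_below:
  assumes "q \<in> exponents_P"
  obtains c where "1 < c" "AE x in lebesgue. c \<le> q x"
proof -
  have "1 < essinf lebesgue (\<lambda>x. ereal (q x))" using assms by (simp add: exponents_P_def)
  then obtain c where c: "1 < ereal c" "ereal c < essinf lebesgue (\<lambda>x. ereal (q x))"
    using ereal_dense2 by blast
  then have "AE x in lebesgue. ereal c < ereal (q x)"
    unfolding essinf_def using le_Liminf_iff[of _ "ae_filter lebesgue" "\<lambda>x. ereal (q x)"] by blast
  then have "AE x in lebesgue. c \<le> q x" by eventually_elim simp
  with c that show thesis by simp
qed

lemma lux_norm_indicator_finite:
  assumes q: "AE x in M. 1 \<le> q x" and S: "S \<in> sets M" "emeasure M S < top"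
  shows "lux_norm M q (indicator S) < top"
proof -
  define \<zeta> where "\<zeta> = max 1 (measure M S)"
  have \<zeta>: "1 \<le> \<zeta>" "measure M S \<le> \<zeta>" by (auto simp: \<zeta>_def)
  have "modular M q (indicator S) \<zeta> \<le> (\<integral>\<^sup>+ x. ennreal (1 / \<zeta>) * indicator S x \<partial>M)"
    unfolding modular_def
  proof (rule nn_integral_mono_AE, use q in eventually_elim)
    fix x assume x: "1 \<le> q x"
    have "epowr (indicator S x / ennreal 1) (q x) = indicator S x"
      using x by (simp add: indicator_def epowr_def)
    then show "epowr (indicator S x / ennreal \<zeta>) (q x) \<le> ennreal (1 / \<zeta>) * indicator S x"
      using epowr_rescale_le[of 1 \<zeta> "q x" "indicator S x"] x \<zeta> by simp
  qed
  also have "\<dots> = ennreal (1 / \<zeta>) * ennreal (measure M S)"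
    using S by (simp add: nn_integral_cmult emeasure_eq_ennreal_measure)
  also have "\<dots> \<le> 1"
    using \<zeta> by (simp add: divide_le_eq flip: ennreal_mult)
  finally have "lux_norm M q (indicator S) \<le> ennreal \<zeta>"
    using \<zeta> by (intro lux_norm_le) auto
  then show ?thesis using ennreal_less_top le_less_trans by blast
qed

text \<open>
  By Hoelder's inequality, the measure of \<open>S\<close> is at most twice the product of the two norms.
\<close>
lemma lux_norm_indicator_nonzero:
  assumes q: "AE x in M. 1 < q x" "AE x in M. 1 \<le> conj_exp q x" "q \<in> borel_measurable M"
    and S: "S \<in> sets M" "0 < emeasure M S" "emeasure M S < top"
  shows "lux_norm M q (indicator S) \<noteq> 0" "lux_norm M (conj_exp q) (indicator S) \<noteq> 0"
proof -
  have fin: "lux_norm M q (indicator S) < top" "lux_norm M (conj_exp q) (indicator S) < top"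
    using q S by (auto intro!: lux_norm_indicator_finite elim!: eventually_mono)
  have "emeasure M S = (\<integral>\<^sup>+ x. indicator S x * indicator S x \<partial>M)"
    using S by (simp flip: indicator_inter_arith)
  also have "\<dots> \<le> 2 * lux_norm M q (indicator S) * lux_norm M (conj_exp q) (indicator S)"
    by (rule nn_integral_mult_le_lux_norm[OF q(1,3) _ _ fin]) (use S in auto)
  finally show "lux_norm M q (indicator S) \<noteq> 0" "lux_norm M (conj_exp q) (indicator S) \<noteq> 0"
    using S by auto
qed

lemma conj_exp_bounds:
  assumes "1 < c" "c \<le> q x"
  shows "1 \<le> conj_exp q x" "conj_exp q x \<le> c / (c - 1)"
  using assms by (auto simp: conj_exp_def field_simps)

text \<open>
  The Muckenhoupt-type condition on balls that boundedness of the maximal operator implies.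
  Let \<open>\<eta>\<close> be close to the dual norm of the indicator of \<open>B\<close>, and test the maximal operator on
  the extremal function \<open>g = \<eta> powr (1 - q')\<close> on \<open>B\<close> of Hoelder's inequality.  The modular \<open>m\<close> of \<open>g\<close> is that of
  the indicator at \<open>\<eta>\<close>, hence at most 1, while its integral over \<open>B\<close> is \<open>\<eta> * m\<close>.  The maximal function is at least
  \<open>\<eta> * m / \<bar>B\<bar>\<close> on \<open>B\<close>.  Since \<open>q'\<close> is essentially bounded, halving \<open>\<eta>\<close> changes the modular by a
  bounded factor, so \<open>m\<close> is bounded away from 0.
\<close>
lemma lux_norm_ball_product_le:
  fixes q :: "real^'n \<Rightarrow> real"
  assumes "q \<in> exponents_B"
  obtains K where "0 < K"
    "\<And>c r. 0 < r \<Longrightarrow> lux_norm lebesgue q (indicator (ball c r)) *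
       lux_norm lebesgue (conj_exp q) (indicator (ball c r)) \<le> ennreal K * emeasure lebesgue (ball c r)"
proof -
  have qP: "q \<in> exponents_P" and [measurable]: "q \<in> borel_measurable lebesgue"
    using assms by (auto simp: exponents_B_def exponents_P_def)
  have [measurable]: "conj_exp q \<in> borel_measurable lebesgue" unfolding conj_exp_def by measurable
  obtain C' where C': "\<And>f. f \<in> Lq lebesgue q \<Longrightarrow>
      lux_norm lebesgue q (HL_maximal f) \<le> ennreal C' * Lq_norm q f"
    using assms by (auto simp: exponents_B_def)
  define C where "C = max C' 1"
  obtain s where s: "1 < s" "AE x in lebesgue. s \<le> q x"
    using exponents_P_AE_bounded_below[OF qP] .
  define Q where "Q = s / (s - 1)"
  have q1: "AE x in lebesgue. 1 < q x" using s(2) by eventually_elim (use s(1) in auto)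
  have q1': "AE x in lebesgue. 1 \<le> conj_exp q x" "AE x in lebesgue. conj_exp q x \<le> Q"
    using s(2) conj_exp_bounds[OF s(1), of q] by (auto simp: Q_def elim!: eventually_mono)
  show thesis
  proof (rule that)
    show "0 < C * 2 powr Q" by (simp add: C_def)
    fix c :: "real^'n" and r :: real assume r: "0 < r"
    define B where "B = ball c r"
    have [measurable]: "B \<in> sets lebesgue" by (simp add: B_def)
    define b where "b = measure lebesgue B"
    have b: "0 < b" "emeasure lebesgue B = ennreal b"
      using r by (auto simp: b_def B_def emeasure_eq_measure2)
    have fin: "lux_norm lebesgue q (indicator B) < top" "lux_norm lebesgue (conj_exp q) (indicator B) < top"
      using q1 q1' b by (auto intro!: lux_norm_indicator_finite elim!: eventually_mono)
    have "lux_norm lebesgue (conj_exp q) (indicator B) \<noteq> 0"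
      by (rule lux_norm_indicator_nonzero[OF q1 q1'(1)]) (use b in auto)
    then obtain \<nu> where \<nu>: "0 < \<nu>" "lux_norm lebesgue (conj_exp q) (indicator B) = ennreal \<nu>"
      using fin(2) by (cases "lux_norm lebesgue (conj_exp q) (indicator B)") (auto simp: ennreal_eq_0_iff order_le_less)
    \<comment> \<open>An admissible \<open>\<eta>\<close> whose half is not admissible: this keeps the modular at \<open>\<eta>\<close> away from 0.\<close>
    have "lux_norm lebesgue (conj_exp q) (indicator B) < ennreal (2 * \<nu>)"
      using \<nu> by (simp add: ennreal_less_iff)
    then obtain \<eta> where \<eta>: "0 < \<eta>" "modular lebesgue (conj_exp q) (indicator B) \<eta> \<le> 1" "\<eta> < 2 * \<nu>"
      by (rule lux_norm_obtain) (auto simp: ennreal_less_iff)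
    have \<nu>\<eta>: "\<nu> \<le> \<eta>"
      using lux_norm_le[OF \<eta>(1,2)] \<nu> \<eta> by simp
    define m where "m = modular lebesgue (conj_exp q) (indicator B) \<eta>"
    have "\<not> modular lebesgue (conj_exp q) (indicator B) (\<eta> / 2) \<le> 1"
      using lux_norm_le[of "\<eta> / 2" lebesgue "conj_exp q" "indicator B"] \<nu> \<eta> by auto
    then have "1 \<le> modular lebesgue (conj_exp q) (indicator B) (\<eta> / 2)" by simp
    also have "\<dots> \<le> (\<integral>\<^sup>+ x. ennreal (2 powr Q) * epowr (indicator B x / ennreal \<eta>) (conj_exp q x) \<partial>lebesgue)"
      unfolding modular_def
    proof (rule nn_integral_mono_AE, use q1' in eventually_elim)
      fix x assume x: "1 \<le> conj_exp q x" "conj_exp q x \<le> Q"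
      have "indicator B x / ennreal (\<eta> / 2) = ennreal 2 * (indicator B x / ennreal \<eta>)"
        using \<eta>(1) ennreal_mult[of 2 "1 / \<eta>"] by (auto simp: indicator_def divide_ennreal simp flip: ennreal_1)
      then have "epowr (indicator B x / ennreal (\<eta> / 2)) (conj_exp q x)
          = ennreal (2 powr conj_exp q x) * epowr (indicator B x / ennreal \<eta>) (conj_exp q x)"
        using x by (simp only: epowr_mult epowr_ennreal)
      also have "\<dots> \<le> ennreal (2 powr Q) * epowr (indicator B x / ennreal \<eta>) (conj_exp q x)"
        using x by (intro mult_right_mono ennreal_leI powr_mono) auto
      finally show "epowr (indicator B x / ennreal (\<eta> / 2)) (conj_exp q x) \<le> \<dots>" .
    qed
    also have "\<dots> = ennreal (2 powr Q) * m"
      unfolding m_def modular_def by (rule nn_integral_cmult) measurable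
    finally have m: "1 \<le> ennreal (2 powr Q) * m" .
    define g where "g x = indicat_real B x * \<eta> powr (1 - conj_exp q x)" for x
    have [measurable]: "g \<in> borel_measurable lebesgue" unfolding g_def by measurable
    have g_modular: "modular lebesgue q (ennorm g) 1 = m"
      unfolding modular_def m_def
    proof (rule nn_integral_cong_AE, use q1 in eventually_elim)
      fix x assume x: "1 < q x"
      have "(1 - conj_exp q x) * q x = - conj_exp q x"
        using x by (simp add: conj_exp_def field_simps)
      then show "epowr (ennorm g x / ennreal 1) (q x) = epowr (indicator B x / ennreal \<eta>) (conj_exp q x)"
        using \<eta>(1) by (auto simp: ennorm_def g_def indicator_def epowr_ennreal powr_powr powr_divide
            divide_ennreal powr_minus_divide simp flip: ennreal_1)
    qed
    have g_Lq: "g \<in> Lq lebesgue q"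
      using g_modular \<eta>(2) le_less_trans[of m 1 \<infinity>] unfolding Lq_def by (auto simp: m_def intro!: exI[of _ 1])
    have g_norm: "Lq_norm q g \<le> 1"
      using lux_norm_le[of 1 lebesgue q "ennorm g"] g_modular \<eta>(2) by (simp add: m_def)
    have "(\<integral>\<^sup>+ y\<in>B. ennreal \<bar>g y\<bar> \<partial>lebesgue)
        = (\<integral>\<^sup>+ y. ennreal \<eta> * epowr (indicator B y / ennreal \<eta>) (conj_exp q y) \<partial>lebesgue)"
    proof (rule nn_integral_cong_AE, use q1' in eventually_elim)
      fix x assume "1 \<le> conj_exp q x"
      then show "ennreal \<bar>g x\<bar> * indicator B x
          = ennreal \<eta> * epowr (indicator B x / ennreal \<eta>) (conj_exp q x)"
        using \<eta>(1) by (auto simp: g_def indicator_def epowr_ennreal powr_divide powr_diff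
            divide_ennreal simp flip: ennreal_1 ennreal_mult)
    qed
    also have "\<dots> = ennreal \<eta> * m"
      unfolding m_def modular_def by (rule nn_integral_cmult) measurable
    finally have g_int: "(\<integral>\<^sup>+ y\<in>B. ennreal \<bar>g y\<bar> \<partial>lebesgue) = ennreal \<eta> * m" .
    obtain \<mu> where \<mu>: "0 \<le> \<mu>" "m = ennreal \<mu>"
      using \<eta>(2) unfolding m_def[symmetric] by (cases m) (auto simp: top_unique)
    have \<mu>1: "1 \<le> 2 powr Q * \<mu>"
      using m \<mu> by (simp flip: ennreal_mult)
    then have \<mu>0: "0 < \<mu>" using \<mu> by (cases "\<mu> = 0") auto
    have "ennreal (\<eta> * \<mu> / b) * lux_norm lebesgue q (indicator B) \<le> lux_norm lebesgue q (HL_maximal g)"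
    proof (rule cmult_lux_norm_le)
      show "AE x in lebesgue. ennreal (\<eta> * \<mu> / b) * indicator B x \<le> HL_maximal g x"
      proof (rule AE_I2)
        fix x :: "real^'n"
        show "ennreal (\<eta> * \<mu> / b) * indicator B x \<le> HL_maximal g x"
        proof (cases "x \<in> B")
          case True
          have "(\<integral>\<^sup>+ y\<in>B. ennreal \<bar>g y\<bar> \<partial>lebesgue) / emeasure lebesgue B \<le> HL_maximal g x"
            unfolding HL_maximal_def using True r by (intro SUP_upper) (auto simp: B_def)
          moreover have "ennreal (\<eta> * \<mu>) / ennreal b = ennreal (\<eta> * \<mu> / b)"
            using \<eta> \<mu> b by (intro divide_ennreal) auto
          ultimately show ?thesis
            using True \<eta> \<mu> b g_int by (simp add: ennreal_mult)
        qed simp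
      qed
    qed (use q1 \<eta> \<mu>0 b in \<open>auto elim!: eventually_mono\<close>)
    also have "\<dots> \<le> ennreal C' * Lq_norm q g" by (rule C'[OF g_Lq])
    also have "\<dots> \<le> ennreal C * 1"
      using g_norm by (intro mult_mono ennreal_leI) (auto simp: C_def)
    finally have *: "ennreal (\<eta> * \<mu> / b) * lux_norm lebesgue q (indicator B) \<le> ennreal C" by simp
    obtain \<beta> where \<beta>: "0 \<le> \<beta>" "lux_norm lebesgue q (indicator B) = ennreal \<beta>"
      using fin(1) by (cases "lux_norm lebesgue q (indicator B)") auto
    have "\<eta> * \<mu> / b * \<beta> \<le> C"
      using * \<beta> \<eta> \<mu> b by (simp add: C_def flip: ennreal_mult)
    then have le: "\<eta> * \<mu> * \<beta> \<le> C * b" using b by (simp add: field_simps)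
    have "\<beta> * \<nu> \<le> \<beta> * \<eta> * (2 powr Q * \<mu>)"
      using mult_mono[OF \<nu>\<eta> \<mu>1] mult_left_mono[of \<nu> "\<eta> * (2 powr Q * \<mu>)" \<beta>] \<beta> \<eta> by (simp add: mult.assoc)
    also have "\<dots> \<le> 2 powr Q * (C * b)"
      using mult_left_mono[OF le, of "2 powr Q"] by (simp add: mult_ac)
    finally have "\<beta> * \<nu> \<le> C * 2 powr Q * b" by (simp add: mult_ac)
    then show "lux_norm lebesgue q (indicator (ball c r)) *
       lux_norm lebesgue (conj_exp q) (indicator (ball c r)) \<le> ennreal (C * 2 powr Q) * emeasure lebesgue (ball c r)"
      using \<beta> \<nu> b unfolding B_def[symmetric] by (simp add: C_def ennreal_leI flip: ennreal_mult)
  qed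
qed

lemma emeasure_dyadic_ball:
  "emeasure lebesgue (dyadic_ball j :: (real^'n) set)
    = ennreal (unit_ball_vol (real CARD('n)) * (2 powr of_int j) ^ CARD('n))"
proof -
  have "dyadic_ball j = cball (0 :: real^'n) (2 powr of_int j)"
    by (auto simp: dyadic_ball_def powr_real_of_int')
  then show ?thesis using emeasure_cball[of "2 powr of_int j" "0 :: real^'n"] by simp
qed

text \<open>
  Combines the ball condition with the defining property of \<open>\<delta>\<close>: replacing the dual norm over the
  large ball by that over the smaller one gains a power of the ratio of the radii.  The closed dyadic balls are first
  put into the open ball of twice the radius; the factor \<open>2 ^ n\<close> in the constant pays for this.
\<close>
lemma lux_norm_dyadic_product_le:
  fixes q :: "real^'n \<Rightarrow> real"
  assumes q: "q \<in> exponents_B" and \<delta>: "is_delta2 q \<delta>"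
  obtains K where "0 < K"
    "\<And>j k. j \<le> k \<Longrightarrow> lux_norm lebesgue q (indicator (dyadic_ball k)) *
       lux_norm lebesgue (conj_exp q) (indicator (dyadic_ball j))
       \<le> ennreal (K * (2 powr of_int k) ^ CARD('n) * 2 powr (of_int (j - k) * real CARD('n) * \<delta>))"
proof -
  have q0: "AE x in lebesgue. 0 \<le> q x" and "q \<in> exponents_P"
    using q by (auto simp: exponents_B_def exponents_P_def intro!: AE_I2 order_trans[OF zero_le_one])
  then obtain s where s: "1 < s" "AE x in lebesgue. s \<le> q x"
    using exponents_P_AE_bounded_below by metis
  have q1': "AE x in lebesgue. 1 \<le> conj_exp q x"
    using s(2) conj_exp_bounds[OF s(1), of q] by (auto elim!: eventually_mono)
  have q0': "AE x in lebesgue. 0 \<le> conj_exp q x" using q1' by eventually_elim simp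
  obtain C where C: "0 < C" "\<And>c r S. 0 < r \<Longrightarrow> S \<in> sets lebesgue \<Longrightarrow> S \<subseteq> ball c r \<Longrightarrow>
      lux_norm lebesgue (conj_exp q) (indicator S) / lux_norm lebesgue (conj_exp q) (indicator (ball c r))
        \<le> ennreal C * epowr (emeasure lebesgue S / emeasure lebesgue (ball c r)) \<delta>"
    using \<delta> unfolding is_delta2_def ennorm_indicat_real by metis
  have \<delta>0: "0 < \<delta>" using \<delta> by (simp add: is_delta2_def)
  obtain K where K: "0 < K"
    "\<And>c r. 0 < r \<Longrightarrow> lux_norm lebesgue q (indicator (ball c r)) *
       lux_norm lebesgue (conj_exp q) (indicator (ball c r)) \<le> ennreal K * emeasure lebesgue (ball c r)"
    using lux_norm_ball_product_le[OF q] by metis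
  define V where "V = unit_ball_vol (real CARD('n))"
  have V: "0 < V" by (simp add: V_def)
  show thesis
  proof (rule that)
    show "0 < K * C * V * 2 ^ CARD('n)" using C K V by simp
    fix j k :: int assume jk: "j \<le> k"
    define \<rho> where "\<rho> = 2 powr real_of_int (k + 1)"
    define B where "B = ball (0 :: real^'n) \<rho>"
    have \<rho>: "0 < \<rho>" by (simp add: \<rho>_def)
    have sub: "dyadic_ball i \<subseteq> B" if "i \<le> k" for i
    proof -
      have "2 powr real_of_int i < \<rho>" using that by (simp add: \<rho>_def)
      then show ?thesis by (auto simp: B_def dyadic_ball_def powr_real_of_int')
    qed
    have eB: "emeasure lebesgue B = ennreal (V * \<rho> ^ CARD('n))"
      using emeasure_ball[of \<rho> "0 :: real^'n"] \<rho> by (simp add: B_def V_def)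
    have S: "dyadic_ball j \<in> sets lebesgue" by (simp add: dyadic_ball_def)
    let ?N = "lux_norm lebesgue (conj_exp q)"
    have fin: "?N (indicator B) < top"
      using eB by (intro lux_norm_indicator_finite q1') (auto simp: B_def)
    have "emeasure lebesgue (dyadic_ball j :: (real^'n) set) / emeasure lebesgue B
        = ennreal ((2 powr of_int j / \<rho>) ^ CARD('n))"
      unfolding eB emeasure_dyadic_ball using \<rho> V
      by (simp add: V_def[symmetric] divide_ennreal power_divide)
    also have "2 powr of_int j / \<rho> = 2 powr of_int (j - k - 1)"
      by (simp add: \<rho>_def diff_diff_eq flip: powr_diff)
    also have "(2 powr of_int (j - k - 1)) ^ CARD('n) = 2 powr (of_int (j - k - 1) * real CARD('n))"
      by (simp add: powr_powr flip: powr_realpow)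
    finally have ratio: "epowr (emeasure lebesgue (dyadic_ball j :: (real^'n) set) / emeasure lebesgue B) \<delta>
        = ennreal (2 powr (of_int (j - k - 1) * real CARD('n) * \<delta>))"
      by (simp add: epowr_ennreal powr_powr)
    also have "\<dots> \<le> ennreal (2 powr (of_int (j - k) * real CARD('n) * \<delta>))"
      using \<delta>0 by (intro ennreal_leI powr_mono mult_right_mono) auto
    finally have "ennreal C * epowr (emeasure lebesgue (dyadic_ball j :: (real^'n) set) / emeasure lebesgue B) \<delta>
        \<le> ennreal C * ennreal (2 powr (of_int (j - k) * real CARD('n) * \<delta>))"
      by (rule mult_left_mono) simp
    then have "?N (indicator (dyadic_ball j)) / ?N (indicator B)
        \<le> ennreal (C * 2 powr (of_int (j - k) * real CARD('n) * \<delta>))"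
      using C(2)[OF \<rho> S] sub[OF jk] C(1) unfolding B_def by (auto simp: ennreal_mult intro: order_trans)
    then have "?N (indicator B) * (?N (indicator (dyadic_ball j)) / ?N (indicator B))
        \<le> ?N (indicator B) * ennreal (C * 2 powr (of_int (j - k) * real CARD('n) * \<delta>))"
      by (rule mult_left_mono) simp
    moreover have "?N (indicator (dyadic_ball j)) \<le> ?N (indicator B) * (?N (indicator (dyadic_ball j)) / ?N (indicator B))"
    proof (cases "?N (indicator B) = 0")
      case True
      have "?N (indicator (dyadic_ball j)) \<le> ?N (indicator B)"
        using sub[OF jk] by (intro lux_norm_mono_AE[OF q0'] AE_I2) (auto simp: indicator_def)
      with True show ?thesis by simp
    next
      case False
      then show ?thesis
        using fin mult_divide_eq_ennreal[of "?N (indicator B)" "?N (indicator (dyadic_ball j))"]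
        by (auto simp: ennreal_times_divide mult.commute)
    qed
    ultimately have "?N (indicator (dyadic_ball j))
        \<le> ?N (indicator B) * ennreal (C * 2 powr (of_int (j - k) * real CARD('n) * \<delta>))"
      by (rule order_trans[rotated])
    moreover have "lux_norm lebesgue q (indicator (dyadic_ball k)) \<le> lux_norm lebesgue q (indicator B)"
      using sub[of k] by (intro lux_norm_mono_AE[OF q0] AE_I2) (auto simp: indicator_def)
    ultimately have "lux_norm lebesgue q (indicator (dyadic_ball k)) * ?N (indicator (dyadic_ball j))
        \<le> lux_norm lebesgue q (indicator B) *
          (?N (indicator B) * ennreal (C * 2 powr (of_int (j - k) * real CARD('n) * \<delta>)))"
      by (intro mult_mono) auto
    also have "\<dots> \<le> ennreal K * emeasure lebesgue B * ennreal (C * 2 powr (of_int (j - k) * real CARD('n) * \<delta>))"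
      using K(2)[OF \<rho>, of 0] unfolding B_def[symmetric] mult.assoc[symmetric] by (rule mult_right_mono) simp
    also have "\<dots> = ennreal (K * (V * \<rho> ^ CARD('n)) * (C * 2 powr (of_int (j - k) * real CARD('n) * \<delta>)))"
      using K(1) C(1) V \<rho> by (simp add: eB flip: ennreal_mult)
    also have "\<rho> = 2 * 2 powr of_int k" by (simp add: \<rho>_def powr_add)
    finally show "lux_norm lebesgue q (indicator (dyadic_ball k)) * ?N (indicator (dyadic_ball j))
       \<le> ennreal (K * C * V * 2 ^ CARD('n) * (2 powr of_int k) ^ CARD('n) *
           2 powr (of_int (j - k) * real CARD('n) * \<delta>))"
      by (simp add: power_mult_distrib mult_ac)
  qed
qed

section \<open>Dyadic decomposition of functions\<close>

lemma ennorm_restr: "ennorm (restr A f) x = indicator A x * ennorm f x"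
  by (auto simp: ennorm_def restr_def indicator_def)

lemma measurable_restr [measurable]:
  fixes f :: "'a \<Rightarrow> 'b::euclidean_space"
  assumes "A \<in> sets M" "f \<in> borel_measurable M"
  shows "restr A f \<in> borel_measurable M"
  using assms unfolding restr_def by measurable

lemma measurable_ennorm [measurable]:
  assumes "f \<in> borel_measurable M"
  shows "ennorm f \<in> borel_measurable M"
  using assms unfolding ennorm_def by measurable

lemma restr_add_compl: "(\<lambda>x. restr A f x + restr (- A) f x) = f"
  by (auto simp: restr_def indicator_def)

lemma dyadic_sets [measurable, simp]:
  "dyadic_ball k \<in> sets lebesgue" "dyadic_annulus k \<in> sets lebesgue"
  by (auto simp: dyadic_ball_def dyadic_annulus_def intro!: sets.Diff)

lemma mem_dyadic_ball_iff:
  assumes "x \<in> dyadic_annulus j"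
  shows "x \<in> dyadic_ball m \<longleftrightarrow> j \<le> m"
proof
  assume "x \<in> dyadic_ball m"
  then have "(2::real) powi (j - 1) < 2 powi m"
    using assms by (auto simp: dyadic_annulus_def dyadic_ball_def)
  then show "j \<le> m" using power_int_increasing[of m "j - 1" "2::real"] by linarith
next
  assume "j \<le> m"
  then have "(2::real) powi j \<le> 2 powi m" by (intro power_int_increasing) auto
  then show "x \<in> dyadic_ball m"
    using assms by (auto simp: dyadic_annulus_def dyadic_ball_def)
qed

lemma dyadic_annulus_cover:
  assumes "x \<noteq> 0"
  obtains j where "x \<in> dyadic_annulus j"
proof -
  have x: "0 < norm x" using assms by simp
  define j where "j = \<lceil>log 2 (norm x)\<rceil>"
  have "log 2 (norm x) \<le> of_int j" "of_int (j - 1) < log 2 (norm x)"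
    unfolding j_def by linarith+
  then have "norm x \<le> 2 powr of_int j" "2 powr of_int (j - 1) < norm x"
    using x by (auto simp: log_le_iff less_log_iff)
  moreover have "(2::real) powr of_int i = 2 powi i" for i
    by (rule powr_real_of_int') auto
  ultimately have "x \<in> dyadic_annulus j"
    by (simp only: dyadic_annulus_def dyadic_ball_def) auto
  then show thesis by (rule that)
qed

lemma AE_lebesgue_nonzero: "AE x in lebesgue. (x :: real^'n) \<noteq> 0"
  by (rule AE_I'[of "{0}"]) (auto intro: negligible_imp_measure0 simp: negligible_iff_null_sets[symmetric])

text \<open>
  The punctured space is a countable union of compact shells; the value at the origin is harmless
  because a single point is a measurable set.
\<close>
lemma borel_measurable_Lq_loc_punctured:
  fixes f :: "real^'n \<Rightarrow> 'b::euclidean_space"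
  assumes "f \<in> Lq_loc (- {0}) q"
  shows "f \<in> borel_measurable lebesgue"
proof -
  define F :: "nat \<Rightarrow> (real^'n) set" where "F n = cball 0 (real n) - ball 0 (1 / real (Suc n))" for n
  have F: "compact (F n)" "F n \<subseteq> - {0}" for n
    unfolding F_def by (auto intro: compact_diff)
  have cover: "\<exists>n. x \<in> F n" if "x \<noteq> 0" for x
  proof -
    obtain n where n: "inverse (real (Suc n)) < norm x" using reals_Archimedean[of "norm x"] \<open>x \<noteq> 0\<close> by auto
    obtain m where m: "norm x \<le> real m" using real_arch_simple by blast
    have "inverse (real (Suc (max n m))) \<le> inverse (real (Suc n))" by (intro le_imp_inverse_le) auto
    with n m have "x \<in> F (max n m)" by (auto simp: F_def inverse_eq_divide)
    then show ?thesis ..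
  qed
  show ?thesis
  proof (rule measurable_piecewise_restrict[of "insert {0} (range F)"])
    show "space lebesgue \<subseteq> \<Union> (insert {0} (range F))" using cover by auto
    fix X assume X: "X \<in> insert {0} (range F)"
    show "X \<inter> space lebesgue \<in> sets lebesgue" using X F(1) by (auto intro: lmeasurable_compact fmeasurableD)
    show "f \<in> borel_measurable (lebesgue_on X)"
    proof (cases "X = {0}")
      case True
      have "(\<lambda>_. f 0) \<in> borel_measurable (lebesgue_on X)" by simp
      then show ?thesis
        by (rule measurable_cong[THEN iffD1, rotated]) (auto simp: True space_restrict_space)
    next
      case False
      then show ?thesis using X F assms by (auto simp: Lq_loc_def Lq_def)
    qed
  qed auto
qed

lemma WLq_norm_le_Lq_norm:
  assumes "AE x in lebesgue. 0 \<le> q x"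
  shows "WLq_norm q f \<le> Lq_norm q f"
  unfolding WLq_norm_def ennorm_indicat_real
proof (rule SUP_least)
  fix t :: real assume "t \<in> {0<..}"
  then show "ennreal t * lux_norm lebesgue q (indicator {x. t < norm (f x)}) \<le> Lq_norm q f"
    by (intro cmult_lux_norm_le[OF assms] AE_I2) (auto simp: ennorm_def indicator_def ennreal_leI)
qed

lemma integrable_imp_L1_loc:
  fixes f :: "real^'n \<Rightarrow> 'b::euclidean_space"
  assumes [measurable]: "f \<in> borel_measurable lebesgue" and fin: "(\<integral>\<^sup>+ x. ennorm f x \<partial>lebesgue) < top"
  shows "f \<in> L1_loc"
proof -
  have "f \<in> Lq (lebesgue_on F) (\<lambda>_. 1)" if "compact F" for F
  proof -
    have F: "F \<in> sets lebesgue" using that by (auto intro: lmeasurable_compact fmeasurableD)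
    have "modular (lebesgue_on F) (\<lambda>_. 1) (ennorm f) 1 = (\<integral>\<^sup>+ x. ennorm f x * indicator F x \<partial>lebesgue)"
      using F mult_divide_eq_ennreal[of 1] by (simp add: modular_def nn_integral_restrict_space)
    also have "\<dots> \<le> (\<integral>\<^sup>+ x. ennorm f x \<partial>lebesgue)"
      by (intro nn_integral_mono) (auto simp: indicator_def)
    finally have "modular (lebesgue_on F) (\<lambda>_. 1) (ennorm f) 1 < \<infinity>" using fin by simp
    then show ?thesis
      unfolding Lq_def by (auto intro!: exI[of _ 1] measurable_restrict_space1)
  qed
  then show ?thesis by (auto simp: Lq_loc_def)
qed

section \<open>Norms of the inner and the outer part\<close>

definition annulus_norm :: "(real^'n \<Rightarrow> real) \<Rightarrow> (real^'n \<Rightarrow> 'b::real_normed_vector) \<Rightarrow> int \<Rightarrow> ennreal" where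
  "annulus_norm q f k = Lq_norm q (restr (dyadic_annulus k) f)"

lemma Lq_norm_outside_le:
  fixes f :: "real^'n \<Rightarrow> 'b::euclidean_space"
  assumes q: "\<And>x. 1 \<le> q x" and [measurable]: "q \<in> borel_measurable lebesgue" "f \<in> borel_measurable lebesgue"
  shows "Lq_norm q (restr (- dyadic_ball (k - 3)) f) \<le> outer_sum 2 (annulus_norm q f) k"
  unfolding outer_sum_def annulus_norm_def
proof (rule lux_norm_le_suminf)
  show "AE x in lebesgue. \<exists>n. ennorm (restr (- dyadic_ball (k - 3)) f) x
      \<le> ennorm (restr (dyadic_annulus (k - 2 + int n)) f) x"
    using AE_lebesgue_nonzero
  proof eventually_elim
    fix x :: "real^'n" assume "x \<noteq> 0"
    then obtain j where j: "x \<in> dyadic_annulus j" by (rule dyadic_annulus_cover)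
    show "\<exists>n. ennorm (restr (- dyadic_ball (k - 3)) f) x \<le> ennorm (restr (dyadic_annulus (k - 2 + int n)) f) x"
    proof (cases "j \<le> k - 3")
      case True
      with j show ?thesis by (simp add: ennorm_restr mem_dyadic_ball_iff)
    next
      case False
      then have "k - 2 + int (nat (j - k + 2)) = j" by simp
      then show ?thesis using j by (intro exI[of _ "nat (j - k + 2)"]) (auto simp: ennorm_restr indicator_def)
    qed
  qed
qed (use q in auto)

text \<open>
  The integral of the inner part is estimated annulus by annulus with Hoelder's inequality, putting
  the indicator of the ball \<open>B\<^sub>j\<close> into the dual norm; the product of that dual norm with the norm of
  the indicator of \<open>B\<^sub>k\<close> is what \<open>lux_norm_dyadic_product_le\<close> controls.
\<close>
lemma lux_norm_ball_times_integral_le: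
  fixes q :: "real^'n \<Rightarrow> real" and f :: "real^'n \<Rightarrow> 'b::euclidean_space"
  assumes q: "AE x in lebesgue. 1 < q x" "AE x in lebesgue. 1 \<le> conj_exp q x"
    and [measurable]: "q \<in> borel_measurable lebesgue" "f \<in> borel_measurable lebesgue"
    and K: "0 < K" "\<And>j k. j \<le> k \<Longrightarrow> lux_norm lebesgue q (indicator (dyadic_ball k)) *
       lux_norm lebesgue (conj_exp q) (indicator (dyadic_ball j))
       \<le> ennreal (K * (2 powr of_int k) ^ CARD('n) * 2 powr (of_int (j - k) * real CARD('n) * \<delta>))"
    and fin: "\<And>j. annulus_norm q f j < top"
  shows "lux_norm lebesgue q (indicator (dyadic_ball k)) * (\<integral>\<^sup>+ x. ennorm (restr (dyadic_ball (k - 3)) f) x \<partial>lebesgue)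
    \<le> ennreal (2 * K * (2 powr of_int k) ^ CARD('n)) * inner_sum (real CARD('n) * \<delta>) (annulus_norm q f) k"
proof -
  let ?L = "lux_norm lebesgue q (indicator (dyadic_ball k))"
  let ?N = "\<lambda>j. lux_norm lebesgue (conj_exp q) (indicator (dyadic_ball j))"
  let ?j = "\<lambda>n. k - 3 - int n"
  have finN: "?N j < top" for j
    using q(2) by (intro lux_norm_indicator_finite) (auto simp: emeasure_dyadic_ball)
  have "(\<integral>\<^sup>+ x. ennorm (restr (dyadic_ball (k - 3)) f) x \<partial>lebesgue)
      \<le> (\<integral>\<^sup>+ x. (\<Sum>n. ennorm (restr (dyadic_annulus (?j n)) f) x * indicator (dyadic_ball (?j n)) x) \<partial>lebesgue)"
  proof (rule nn_integral_mono_AE, use AE_lebesgue_nonzero in eventually_elim)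
    fix x :: "real^'n" assume "x \<noteq> 0"
    then obtain j where j: "x \<in> dyadic_annulus j" by (rule dyadic_annulus_cover)
    show "ennorm (restr (dyadic_ball (k - 3)) f) x
      \<le> (\<Sum>n. ennorm (restr (dyadic_annulus (?j n)) f) x * indicator (dyadic_ball (?j n)) x)" (is "_ \<le> (\<Sum>n. ?F n)")
    proof (cases "j \<le> k - 3")
      case True
      then have *: "?j (nat (k - 3 - j)) = j" by simp
      have "ennorm (restr (dyadic_ball (k - 3)) f) x \<le> ?F (nat (k - 3 - j))"
        unfolding * using j by (auto simp: ennorm_restr indicator_def mem_dyadic_ball_iff)
      also have "\<dots> \<le> (\<Sum>n. ?F n)" using sum_le_suminf[of ?F "{nat (k - 3 - j)}"] by simp
      finally show ?thesis .
    next
      case False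
      with j show ?thesis by (simp add: ennorm_restr mem_dyadic_ball_iff)
    qed
  qed
  also have "\<dots> = (\<Sum>n. \<integral>\<^sup>+ x. ennorm (restr (dyadic_annulus (?j n)) f) x * indicator (dyadic_ball (?j n)) x \<partial>lebesgue)"
    by (rule nn_integral_suminf) simp
  also have "\<dots> \<le> (\<Sum>n. 2 * annulus_norm q f (?j n) * ?N (?j n))"
    using fin finN unfolding annulus_norm_def
    by (intro suminf_le nn_integral_mult_le_lux_norm q) auto
  finally have "?L * (\<integral>\<^sup>+ x. ennorm (restr (dyadic_ball (k - 3)) f) x \<partial>lebesgue)
      \<le> ?L * (\<Sum>n. 2 * annulus_norm q f (?j n) * ?N (?j n))"
    by (rule mult_left_mono) simp
  also have "\<dots> = (\<Sum>n. 2 * annulus_norm q f (?j n) * (?L * ?N (?j n)))"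
    by (simp add: mult_ac flip: ennreal_suminf_cmult)
  also have "\<dots> \<le> (\<Sum>n. ennreal (2 * K * (2 powr of_int k) ^ CARD('n)) *
      (ennreal (2 powr (- (real n + 3) * (real CARD('n) * \<delta>))) * annulus_norm q f (?j n)))"
  proof (intro suminf_le)
    fix n
    have "?L * ?N (?j n) \<le> ennreal (K * (2 powr of_int k) ^ CARD('n) * 2 powr (of_int (?j n - k) * real CARD('n) * \<delta>))"
      by (rule K(2)) simp
    also have "of_int (?j n - k) * real CARD('n) * \<delta> = - (real n + 3) * (real CARD('n) * \<delta>)"
      by (simp add: algebra_simps)
    finally have "2 * annulus_norm q f (?j n) * (?L * ?N (?j n)) \<le> 2 * annulus_norm q f (?j n) *
        ennreal (K * (2 powr of_int k) ^ CARD('n) * 2 powr (- (real n + 3) * (real CARD('n) * \<delta>)))"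
      by (rule mult_left_mono) simp
    also have "\<dots> = ennreal (2 * K * (2 powr of_int k) ^ CARD('n)) *
      (ennreal (2 powr (- (real n + 3) * (real CARD('n) * \<delta>))) * annulus_norm q f (?j n))"
      using K(1) by (simp add: ennreal_mult mult_ac)
    finally show "2 * annulus_norm q f (?j n) * (?L * ?N (?j n)) \<le> \<dots>" .
  qed auto
  also have "\<dots> = ennreal (2 * K * (2 powr of_int k) ^ CARD('n)) * inner_sum (real CARD('n) * \<delta>) (annulus_norm q f) k"
    by (simp add: inner_sum_def)
  finally show ?thesis .
qed

section \<open>Operators on homogeneous Herz spaces\<close>

lemma maps_continuouslyE:
  assumes "maps_continuously D T X nX Y nY"
  obtains C where "0 \<le> C" "X \<subseteq> D" "\<And>f. f \<in> X \<Longrightarrow> T f \<in> Y" "\<And>f. f \<in> X \<Longrightarrow> nY (T f) \<le> ennreal C * nX f"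
proof -
  obtain C :: real where C: "X \<subseteq> D" "\<And>f. f \<in> X \<Longrightarrow> T f \<in> Y \<and> nY (T f) \<le> ennreal C * nX f"
    using assms unfolding maps_continuously_def by auto
  have "ennreal C * nX f \<le> ennreal (max C 0) * nX f" for f
    by (intro mult_right_mono ennreal_leI) auto
  with C show thesis by (intro that[of "max C 0"]) (auto intro: order_trans)
qed

lemma Lq_norm_superlevel_le_WLq_norm: "0 < t \<Longrightarrow> ennreal t * lux_norm lebesgue q (indicator {x. t < norm (f x)}) \<le> WLq_norm q f"
  unfolding WLq_norm_def ennorm_indicat_real[symmetric] by (rule SUP_upper) simp

lemma hom_Herz_norm_eq: "hom_Herz_norm \<alpha> p q f = epowr (herz_sum \<alpha> p (annulus_norm q f)) (1 / p)"
  by (simp add: hom_Herz_norm_def herz_sum_def annulus_norm_def)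

text \<open>
  On the annulus of index \<open>k\<close> the size condition bounds the image of the inner part by a constant
  \<open>m\<close> of order \<open>2 powr (- k * n)\<close> times the \<open>L\<^sup>1\<close> norm.  A superlevel set at height \<open>t\<close> is therefore
  null unless \<open>t \<le> m\<close>, and is always contained in the ball \<open>B\<^sub>k\<close>.  The finiteness of the bound makes the
  inner part integrable, which is what puts it into the domain of the operator.
\<close>
lemma size_condition_annulus_estimate:
  fixes T :: "(real^'n \<Rightarrow> 'b::{real_normed_field,euclidean_space}) \<Rightarrow> real^'n \<Rightarrow> 'b"
  assumes q: "q \<in> exponents_B" and \<delta>: "is_delta2 q \<delta>" and size: "size_condition D T"
  obtains K where "0 \<le> K"
    "\<And>f k. f \<in> borel_measurable lebesgue \<Longrightarrow> (\<And>j. annulus_norm q f j < top) \<Longrightarrow>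
       inner_sum (real CARD('n) * \<delta>) (annulus_norm q f) k < top \<Longrightarrow> restr (dyadic_ball (k - 3)) f \<in> D"
    "\<And>f k t. f \<in> borel_measurable lebesgue \<Longrightarrow> (\<And>j. annulus_norm q f j < top) \<Longrightarrow>
       inner_sum (real CARD('n) * \<delta>) (annulus_norm q f) k < top \<Longrightarrow> 0 < t \<Longrightarrow>
       ennreal t * lux_norm lebesgue q (indicator {x \<in> dyadic_annulus k. t < norm (T (restr (dyadic_ball (k - 3)) f) x)})
         \<le> ennreal K * inner_sum (real CARD('n) * \<delta>) (annulus_norm q f) k"
proof -
  have qP: "q \<in> exponents_P" and qm[measurable]: "q \<in> borel_measurable lebesgue" and q1: "\<And>x. 1 \<le> q x"
    using q by (auto simp: exponents_B_def exponents_P_def)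
  have q0: "AE x in lebesgue. 0 \<le> q x" using q1 by (intro AE_I2) (meson zero_le_one order_trans)
  obtain s where s: "1 < s" "AE x in lebesgue. s \<le> q x"
    using exponents_P_AE_bounded_below[OF qP] .
  have q1': "AE x in lebesgue. 1 < q x" "AE x in lebesgue. 1 \<le> conj_exp q x"
    using s(1) conj_exp_bounds[OF s(1), of q] s(2) by (auto elim!: eventually_mono)
  obtain K where K: "0 < K"
    "\<And>j k. j \<le> k \<Longrightarrow> lux_norm lebesgue q (indicator (dyadic_ball k)) *
       lux_norm lebesgue (conj_exp q) (indicator (dyadic_ball j))
       \<le> ennreal (K * (2 powr of_int k) ^ CARD('n) * 2 powr (of_int (j - k) * real CARD('n) * \<delta>))"
    using lux_norm_dyadic_product_le[OF q \<delta>] by metis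
  obtain C :: real where C: "\<forall>r>0. \<forall>f\<in>L1_loc. closure {x. f x \<noteq> 0} \<subseteq> ball 0 r \<longrightarrow>
    f \<in> D \<and> (AE x in lebesgue. x \<notin> ball 0 (2 * r) \<longrightarrow>
        ennreal (norm (T f x)) \<le> ennreal (C / norm x ^ CARD('n)) * (\<integral>\<^sup>+ y. ennreal (norm (f y)) \<partial>lebesgue))"
    using size unfolding size_condition_def by blast
  define c where "c = max C 0 * 2 ^ CARD('n)"
  have c: "0 \<le> c" by (simp add: c_def)
  have lux_pos: "lux_norm lebesgue q (indicator (dyadic_ball k)) \<noteq> 0" for k :: int
    by (rule lux_norm_indicator_nonzero[OF q1' qm]) (auto simp: emeasure_dyadic_ball)
  show thesis
  proof (rule that)
    show "0 \<le> c * (2 * K)" using c K by simp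
    fix f :: "real^'n \<Rightarrow> 'b" and k :: int
    assume [measurable]: "f \<in> borel_measurable lebesgue" and fin: "\<And>j. annulus_norm q f j < top"
      and fin': "inner_sum (real CARD('n) * \<delta>) (annulus_norm q f) k < top"
    let ?L = "lux_norm lebesgue q (indicator (dyadic_ball k))"
    define g where "g = restr (dyadic_ball (k - 3)) f"
    have [measurable]: "g \<in> borel_measurable lebesgue" by (simp add: g_def)
    define I where "I = (\<integral>\<^sup>+ x. ennorm g x \<partial>lebesgue)"
    have LI: "?L * I \<le> ennreal (2 * K * (2 powr of_int k) ^ CARD('n)) * inner_sum (real CARD('n) * \<delta>) (annulus_norm q f) k"
      unfolding I_def g_def by (rule lux_norm_ball_times_integral_le[OF q1' _ _ K fin]) auto
    also have "\<dots> < top" using fin' by (auto simp: ennreal_mult_less_top)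
    finally have "I < top"
      using lux_pos[of k] by (auto simp: ennreal_mult_less_top)
    then have L1: "g \<in> L1_loc" by (intro integrable_imp_L1_loc) (auto simp: I_def)
    define r where "r = 2 powr real_of_int (k - 2)"
    \<comment> \<open>The support lies in a closed ball of radius \<open>r / 2\<close>, hence in the open ball of radius \<open>r\<close>,
      and \<open>2 * r\<close> is the inner radius of the annulus; a split at index \<open>k - 2\<close> would leave no such \<open>r\<close>.\<close>
    have "(2::real) powi (k - 3) = 2 powr real_of_int (k - 3)"
      by (rule powr_real_of_int'[symmetric]) auto
    then have radius: "(2::real) powi (k - 3) < r" by (simp add: r_def)
    have "closure {x. g x \<noteq> 0} \<subseteq> cball 0 (2 powi (k - 3))"
      by (rule closure_minimal) (auto simp: g_def restr_def dyadic_ball_def indicator_def split: if_splits)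
    also have "\<dots> \<subseteq> ball 0 r" using radius by auto
    finally have supp: "closure {x. g x \<noteq> 0} \<subseteq> ball 0 r" .
    note size_g = C[rule_format, OF _ L1 supp]
    have r: "0 < r" by (simp add: r_def)
    then show "restr (dyadic_ball (k - 3)) f \<in> D" using size_g by (simp add: g_def)
    define m where "m = ennreal (c / (2 powr of_int k) ^ CARD('n)) * I"
    have Tg: "AE x in lebesgue. x \<in> dyadic_annulus k \<longrightarrow> ennreal (norm (T g x)) \<le> m"
    proof -
      have "AE x in lebesgue. x \<notin> ball 0 (2 * r) \<longrightarrow> ennreal (norm (T g x)) \<le> ennreal (C / norm x ^ CARD('n)) * I"
        using size_g[OF r] by (simp add: I_def ennorm_def)
      then show ?thesis
      proof eventually_elim
        fix x :: "real^'n"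
        assume x: "x \<notin> ball 0 (2 * r) \<longrightarrow> ennreal (norm (T g x)) \<le> ennreal (C / norm x ^ CARD('n)) * I"
        have r2: "2 * r = 2 powr of_int k / 2" by (simp add: r_def powr_diff)
        show "x \<in> dyadic_annulus k \<longrightarrow> ennreal (norm (T g x)) \<le> m"
        proof
          assume xk: "x \<in> dyadic_annulus k"
          have "2 powr real_of_int (k - 1) = (2::real) powi (k - 1)"
            by (rule powr_real_of_int') auto
          then have "2 * r < norm x"
            using xk unfolding r2 by (auto simp: dyadic_annulus_def dyadic_ball_def powr_diff)
          with x have le: "ennreal (norm (T g x)) \<le> ennreal (C / norm x ^ CARD('n)) * I" by simp
          have pos: "0 < 2 powr real_of_int k / 2" by simp
          have "C / norm x ^ CARD('n) \<le> max C 0 / norm x ^ CARD('n)" by (intro divide_right_mono) auto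
          also have "\<dots> \<le> max C 0 / (2 powr of_int k / 2) ^ CARD('n)"
            using \<open>2 * r < norm x\<close> pos unfolding r2
            by (intro divide_left_mono power_mono mult_pos_pos zero_less_power) (auto intro: less_trans)
          also have "\<dots> = c / (2 powr of_int k) ^ CARD('n)" by (simp add: c_def power_divide)
          finally show "ennreal (norm (T g x)) \<le> m"
            using le unfolding m_def by (meson ennreal_leI mult_right_mono order_trans zero_le)
        qed
      qed
    qed
    fix t :: real assume t: "0 < t"
    let ?S = "{x \<in> dyadic_annulus k. t < norm (T g x)}"
    have "ennreal t * lux_norm lebesgue q (indicator ?S) \<le> m * ?L"
    proof (cases "ennreal t \<le> m")
      case True
      moreover have "lux_norm lebesgue q (indicator ?S) \<le> ?L"
        by (intro lux_norm_mono_AE[OF q0] AE_I2) (auto simp: indicator_def dyadic_annulus_def)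
      ultimately show ?thesis by (intro mult_mono) auto
    next
      case False
      have "AE x in lebesgue. indicator ?S x = (0 :: ennreal)"
        using Tg
      proof eventually_elim
        fix x assume "x \<in> dyadic_annulus k \<longrightarrow> ennreal (norm (T g x)) \<le> m"
        then have "x \<notin> ?S" using False by (auto dest: ennreal_leI[OF less_imp_le] intro: order_trans)
        then show "indicator ?S x = (0 :: ennreal)" by simp
      qed
      then show ?thesis by (simp add: lux_norm_AE_zero)
    qed
    also have "\<dots> = ennreal (c / (2 powr of_int k) ^ CARD('n)) * (?L * I)" by (simp add: m_def mult_ac)
    also have "\<dots> \<le> ennreal (c / (2 powr of_int k) ^ CARD('n)) *
        (ennreal (2 * K * (2 powr of_int k) ^ CARD('n)) * inner_sum (real CARD('n) * \<delta>) (annulus_norm q f) k)"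
      by (rule mult_left_mono[OF LI]) simp
    also have "\<dots> = ennreal (c * (2 * K)) * inner_sum (real CARD('n) * \<delta>) (annulus_norm q f) k"
      using c K(1) unfolding mult.assoc[symmetric] by (subst ennreal_mult[symmetric]) (auto simp: field_simps)
    finally show "ennreal t * lux_norm lebesgue q (indicator {x \<in> dyadic_annulus k. t < norm (T (restr (dyadic_ball (k - 3)) f) x)})
         \<le> ennreal (c * (2 * K)) * inner_sum (real CARD('n) * \<delta>) (annulus_norm q f) k"
      unfolding g_def .
  qed
qed

lemma Lq_norm_finite_imp_WLq:
  assumes "AE x in lebesgue. 0 \<le> q x" "f \<in> borel_measurable lebesgue" "Lq_norm q f < top"
  shows "f \<in> WLq q"
  using WLq_norm_le_Lq_norm[OF assms(1), of f] assms(2,3) by (simp add: WLq_def le_less_trans)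

text \<open>
  For each \<open>k\<close> separately, \<open>f\<close> is split at radius \<open>2 powr (k - 3)\<close>.  A superlevel set of the image of \<open>f\<close> at height \<open>t\<close> is covered by those of the two images
  at height \<open>t / 2\<close>: the inner one is controlled by the size condition, the outer one by the weak
  Lebesgue bound together with the embedding of the Lebesgue space into its weak version.
\<close>
lemma hom_Herz_weak_estimate:
  fixes T :: "(real^'n \<Rightarrow> 'b::{real_normed_field,euclidean_space}) \<Rightarrow> real^'n \<Rightarrow> 'b"
  assumes q: "q \<in> exponents_B" and \<delta>: "is_delta2 q \<delta>"
    and \<alpha>: "0 < \<alpha>" "\<alpha> < real CARD('n) * \<delta>" and p: "0 < p" "p \<le> 1"
    and T: "sublinear_op D T" and size: "size_condition D T"
    and weak: "maps_continuously D T (WLq q) (WLq_norm q) (WLq q) (WLq_norm q)"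
  obtains K where "0 \<le> K" "hom_Herz \<alpha> p q \<subseteq> D"
    "\<And>f t. f \<in> hom_Herz \<alpha> p q \<Longrightarrow> 0 < t \<Longrightarrow>
      herz_sum \<alpha> p (\<lambda>k. ennreal t * lux_norm lebesgue q (indicator {x \<in> dyadic_annulus k. t < norm (T f x)}))
        \<le> ennreal K * herz_sum \<alpha> p (annulus_norm q f)"
proof -
  have qm[measurable]: "q \<in> borel_measurable lebesgue" and q1: "\<And>x. 1 \<le> q x"
    using q by (auto simp: exponents_B_def exponents_P_def)
  have q0: "AE x in lebesgue. 0 \<le> q x" using q1 by (intro AE_I2) (meson zero_le_one order_trans)
  let ?\<sigma> = "real CARD('n) * \<delta>"
  obtain K1 where K1: "0 \<le> K1"
    "\<And>f k. f \<in> borel_measurable lebesgue \<Longrightarrow> (\<And>j. annulus_norm q f j < top) \<Longrightarrow>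
       inner_sum ?\<sigma> (annulus_norm q f) k < top \<Longrightarrow> restr (dyadic_ball (k - 3)) f \<in> D"
    "\<And>f k t. f \<in> borel_measurable lebesgue \<Longrightarrow> (\<And>j. annulus_norm q f j < top) \<Longrightarrow>
       inner_sum ?\<sigma> (annulus_norm q f) k < top \<Longrightarrow> 0 < t \<Longrightarrow>
       ennreal t * lux_norm lebesgue q (indicator {x \<in> dyadic_annulus k. t < norm (T (restr (dyadic_ball (k - 3)) f) x)})
         \<le> ennreal K1 * inner_sum ?\<sigma> (annulus_norm q f) k"
    using size_condition_annulus_estimate[OF q \<delta> size] by blast
  obtain K2 where K2: "0 \<le> K2" "WLq q \<subseteq> D" "\<And>f. f \<in> WLq q \<Longrightarrow> WLq_norm q (T f) \<le> ennreal K2 * WLq_norm q f"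
    using weak by (rule maps_continuouslyE) blast
  obtain W1 where W1: "0 \<le> W1" "\<And>a. herz_sum \<alpha> p (inner_sum ?\<sigma> a) \<le> ennreal W1 * herz_sum \<alpha> p a"
    using herz_sum_inner_sum[OF p \<alpha>(2)] by blast
  obtain W2 where W2: "0 \<le> W2" "\<And>a. herz_sum \<alpha> p (outer_sum 2 a) \<le> ennreal W2 * herz_sum \<alpha> p a"
    using herz_sum_outer_sum[OF p \<alpha>(1)] by blast
  define K where "K = (2 * K1) powr p * W1 + (2 * K2) powr p * W2"
  have main: "f \<in> D \<and> (\<forall>t>0. herz_sum \<alpha> p (\<lambda>k. ennreal t * lux_norm lebesgue q (indicator {x \<in> dyadic_annulus k. t < norm (T f x)}))
        \<le> ennreal K * herz_sum \<alpha> p (annulus_norm q f))" if f: "f \<in> hom_Herz \<alpha> p q" for f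
  proof -
    let ?a = "annulus_norm q f"
    have fm[measurable]: "f \<in> borel_measurable lebesgue"
      using f by (auto simp: hom_Herz_def intro: borel_measurable_Lq_loc_punctured)
    have wfin: "herz_sum \<alpha> p ?a < top" using f by (simp add: hom_Herz_def hom_Herz_norm_eq)
    have afin: "?a j < top" for j by (rule herz_sum_finite_imp[OF p(1) wfin])
    have ifin: "inner_sum ?\<sigma> ?a k < top" for k
      by (rule herz_sum_finite_imp[OF p(1) le_less_trans[OF W1(2)]]) (use wfin in \<open>auto simp: ennreal_mult_less_top\<close>)
    have ofin: "outer_sum 2 ?a k < top" for k
      by (rule herz_sum_finite_imp[OF p(1) le_less_trans[OF W2(2)]]) (use wfin in \<open>auto simp: ennreal_mult_less_top\<close>)
    let ?g = "\<lambda>k. restr (dyadic_ball (k - 3)) f" and ?h = "\<lambda>k. restr (- dyadic_ball (k - 3)) f"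
    have hm[measurable]: "?h k \<in> borel_measurable lebesgue" for k
      by (rule measurable_restr) (auto simp: Compl_in_sets_lebesgue)
    have h_norm: "Lq_norm q (?h k) \<le> outer_sum 2 ?a k" for k
      by (rule Lq_norm_outside_le) (use q1 in auto)
    have h_WLq: "?h k \<in> WLq q" for k
      by (rule Lq_norm_finite_imp_WLq[OF q0 hm le_less_trans[OF h_norm ofin]])
    have gD: "?g k \<in> D" for k by (rule K1(2)[OF fm afin ifin])
    have hD: "?h k \<in> D" for k using h_WLq K2(2) by auto
    have fD: "f \<in> D"
      using T gD[of 0] hD[of 0] restr_add_compl[of "dyadic_ball (0 - 3)" f] unfolding sublinear_op_def by metis
    have "herz_sum \<alpha> p (\<lambda>k. ennreal t * lux_norm lebesgue q (indicator {x \<in> dyadic_annulus k. t < norm (T f x)}))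
        \<le> ennreal K * herz_sum \<alpha> p ?a" if t: "0 < t" for t
    proof -
      have "ennreal t * lux_norm lebesgue q (indicator {x \<in> dyadic_annulus k. t < norm (T f x)})
          \<le> ennreal (2 * K1) * inner_sum ?\<sigma> ?a k + ennreal (2 * K2) * outer_sum 2 ?a k" for k
      proof -
        let ?S = "{x \<in> dyadic_annulus k. t < norm (T f x)}"
        let ?S1 = "{x \<in> dyadic_annulus k. t / 2 < norm (T (?g k) x)}" and ?S2 = "{x. t / 2 < norm (T (?h k) x)}"
        have [measurable]: "T (?g k) \<in> borel_measurable lebesgue" "T (?h k) \<in> borel_measurable lebesgue"
          using T gD hD unfolding sublinear_op_def by auto
        have "AE x in lebesgue. norm (T f x) \<le> norm (T (?g k) x) + norm (T (?h k) x)"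
          using T gD[of k] hD[of k] unfolding sublinear_op_def
          by (subst restr_add_compl[of "dyadic_ball (k - 3)" f, symmetric]) blast
        then have cover: "AE x in lebesgue. indicator ?S x \<le> (indicator ?S1 x :: ennreal) \<or> indicator ?S x \<le> (indicator ?S2 x :: ennreal)"
          by eventually_elim (auto simp: indicator_def)
        have m1: "indicator ?S1 \<in> borel_measurable lebesgue" "indicator ?S2 \<in> borel_measurable lebesgue"
          by measurable
        have 1: "lux_norm lebesgue q (indicator ?S) \<le> lux_norm lebesgue q (indicator ?S1) + lux_norm lebesgue q (indicator ?S2)"
          by (rule lux_norm_le_add[OF _ qm m1 cover]) (use q1 in auto)
        have 2: "ennreal (t / 2) * lux_norm lebesgue q (indicator ?S1) \<le> ennreal K1 * inner_sum ?\<sigma> ?a k"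
          using t by (intro K1(3)[OF fm afin ifin]) auto
        have "ennreal (t / 2) * lux_norm lebesgue q (indicator ?S2) \<le> WLq_norm q (T (?h k))"
          using t by (intro Lq_norm_superlevel_le_WLq_norm) auto
        also have "\<dots> \<le> ennreal K2 * WLq_norm q (?h k)" by (rule K2(3)[OF h_WLq])
        also have "\<dots> \<le> ennreal K2 * outer_sum 2 ?a k"
          by (intro mult_left_mono order_trans[OF WLq_norm_le_Lq_norm[OF q0] h_norm]) auto
        finally have 3: "ennreal (t / 2) * lux_norm lebesgue q (indicator ?S2) \<le> ennreal K2 * outer_sum 2 ?a k" .
        have t2: "ennreal t = ennreal 2 * ennreal (t / 2)" using t by (subst ennreal_mult[symmetric]) auto
        have "ennreal t * lux_norm lebesgue q (indicator ?S) \<le> ennreal t *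
            (lux_norm lebesgue q (indicator ?S1) + lux_norm lebesgue q (indicator ?S2))"
          by (rule mult_left_mono[OF 1]) simp
        also have "\<dots> = ennreal 2 * (ennreal (t / 2) * lux_norm lebesgue q (indicator ?S1)
            + ennreal (t / 2) * lux_norm lebesgue q (indicator ?S2))"
          unfolding t2 by (simp only: distrib_left mult.assoc)
        also have "\<dots> \<le> ennreal 2 * (ennreal K1 * inner_sum ?\<sigma> ?a k + ennreal K2 * outer_sum 2 ?a k)"
          by (intro mult_left_mono add_mono 2 3) auto
        also have "\<dots> = ennreal (2 * K1) * inner_sum ?\<sigma> ?a k + ennreal (2 * K2) * outer_sum 2 ?a k"
          using K1(1) K2(1) by (simp only: distrib_left mult.assoc[symmetric] ennreal_mult zero_le_numeral)
        finally show ?thesis .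
      qed
      then have "herz_sum \<alpha> p (\<lambda>k. ennreal t * lux_norm lebesgue q (indicator {x \<in> dyadic_annulus k. t < norm (T f x)}))
          \<le> herz_sum \<alpha> p (\<lambda>k. ennreal (2 * K1) * inner_sum ?\<sigma> ?a k + ennreal (2 * K2) * outer_sum 2 ?a k)"
        by (rule herz_sum_mono[OF p(1)])
      also have "\<dots> \<le> herz_sum \<alpha> p (\<lambda>k. ennreal (2 * K1) * inner_sum ?\<sigma> ?a k) + herz_sum \<alpha> p (\<lambda>k. ennreal (2 * K2) * outer_sum 2 ?a k)"
        by (rule herz_sum_add_le[OF p])
      also have "\<dots> \<le> epowr (ennreal (2 * K1)) p * herz_sum \<alpha> p (inner_sum ?\<sigma> ?a) + epowr (ennreal (2 * K2)) p * herz_sum \<alpha> p (outer_sum 2 ?a)"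
        by (intro add_mono herz_sum_cmult_le p)
      also have "\<dots> \<le> epowr (ennreal (2 * K1)) p * (ennreal W1 * herz_sum \<alpha> p ?a) + epowr (ennreal (2 * K2)) p * (ennreal W2 * herz_sum \<alpha> p ?a)"
        by (intro add_mono mult_left_mono W1 W2) auto
      also have "\<dots> = ennreal K * herz_sum \<alpha> p ?a"
      proof -
        have "epowr (ennreal (2 * K1)) p = ennreal ((2 * K1) powr p)" "epowr (ennreal (2 * K2)) p = ennreal ((2 * K2) powr p)"
          using K1(1) K2(1) epowr_ennreal[of "2 * K1" p] epowr_ennreal[of "2 * K2" p] by auto
        then show ?thesis using W1(1) W2(1) by (simp only: K_def) (simp add: ennreal_mult distrib_right mult.assoc)
      qed
      finally show ?thesis .
    qed
    with fD show ?thesis by blast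
  qed
  show thesis
    by (rule that[of K]) (use main W1(1) W2(1) in \<open>auto simp: K_def\<close>)
qed

lemma hom_Herz_maps_continuously:
  fixes T :: "(real^'n \<Rightarrow> 'b::{real_normed_field,euclidean_space}) \<Rightarrow> real^'n \<Rightarrow> 'b"
  assumes q: "q \<in> exponents_B" and \<delta>: "is_delta2 q \<delta>"
    and \<alpha>: "0 < \<alpha>" "\<alpha> < real CARD('n) * \<delta>" and p: "0 < p" "p \<le> 1"
    and T: "sublinear_op D T" and size: "size_condition D T"
    and weak: "maps_continuously D T (WLq q) (WLq_norm q) (WLq q) (WLq_norm q)"
  shows "maps_continuously D T (hom_Herz \<alpha> p q) (hom_Herz_norm \<alpha> p q)
           (weak_hom_Herz \<alpha> p q) (weak_hom_Herz_norm \<alpha> p q)"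
proof -
  obtain K where K: "0 \<le> K" "hom_Herz \<alpha> p q \<subseteq> D"
    "\<And>f t. f \<in> hom_Herz \<alpha> p q \<Longrightarrow> 0 < t \<Longrightarrow>
      herz_sum \<alpha> p (\<lambda>k. ennreal t * lux_norm lebesgue q (indicator {x \<in> dyadic_annulus k. t < norm (T f x)}))
        \<le> ennreal K * herz_sum \<alpha> p (annulus_norm q f)"
    using hom_Herz_weak_estimate[OF q \<delta> \<alpha> p T size weak] by blast
  have le: "weak_hom_Herz_norm \<alpha> p q (T f) \<le> ennreal (K powr (1 / p)) * hom_Herz_norm \<alpha> p q f"
    if f: "f \<in> hom_Herz \<alpha> p q" for f
    unfolding weak_hom_Herz_norm_def ennorm_indicat_real hom_Herz_norm_eq
  proof (rule SUP_least)
    fix t :: real assume "t \<in> {0<..}"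
    then have t: "0 < t" by simp
    show "ennreal t * epowr (\<Sum>\<^sub>\<infinity>k. ennreal (2 powr (real_of_int k * \<alpha> * p)) *
        epowr (lux_norm lebesgue q (indicator {x \<in> dyadic_annulus k. t < norm (T f x)})) p) (1 / p)
      \<le> ennreal (K powr (1 / p)) * epowr (herz_sum \<alpha> p (annulus_norm q f)) (1 / p)"
      unfolding mult_epowr_root[OF p(1), of t] herz_sum_def[symmetric]
      by (rule epowr_le_root[OF p(1) K(1)]) (rule order_trans[OF epowr_mult_herz_sum_le[OF t p(1)] K(3)[OF f t]])
  qed
  have "T f \<in> weak_hom_Herz \<alpha> p q" if f: "f \<in> hom_Herz \<alpha> p q" for f
  proof -
    have "T f \<in> borel_measurable lebesgue" using T f K(2) unfolding sublinear_op_def by blast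
    moreover have "weak_hom_Herz_norm \<alpha> p q (T f) < top"
      using f by (intro le_less_trans[OF le[OF f]]) (auto simp: hom_Herz_def ennreal_mult_less_top)
    ultimately show ?thesis by (simp add: weak_hom_Herz_def)
  qed
  with le K(2) show ?thesis unfolding maps_continuously_def by blast
qed

section \<open>Operators on inhomogeneous Herz spaces\<close>

text \<open>
  The sequence entering the inhomogeneous norm, extended by 0 to the negative indices, so that this norm
  is a Herz sum as well and the shift estimates apply to it.
\<close>
definition inhom_annulus_norm :: "(real^'n \<Rightarrow> real) \<Rightarrow> (real^'n \<Rightarrow> 'b::real_normed_vector) \<Rightarrow> int \<Rightarrow> ennreal" where
  "inhom_annulus_norm q f k =
     (if k < 0 then 0 else Lq_norm q (restr (if k = 0 then dyadic_ball 0 else dyadic_annulus k) f))"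

lemma Herz_norm_eq:
  "Herz_norm \<alpha> p q f = epowr (herz_sum \<alpha> p (inhom_annulus_norm q f)) (1 / p)"
proof -
  let ?u = "\<lambda>k. ennreal (2 powr (of_int k * \<alpha> * p)) * epowr (inhom_annulus_norm q f k) p"
  have "herz_sum \<alpha> p (inhom_annulus_norm q f) = infsum ?u (range int)"
    unfolding herz_sum_def
  proof (rule infsum_cong_neutral)
    fix k assume "k \<in> UNIV - range int"
    then have "k < 0" by (metis DiffD2 nonneg_int_cases not_le rangeI)
    then show "?u k = 0" by (simp add: inhom_annulus_norm_def)
  qed auto
  also have "\<dots> = infsum (?u \<circ> int) UNIV" by (rule infsum_reindex) simp
  also have "?u \<circ> int = (\<lambda>k. ennreal (2 powr (of_nat k * \<alpha> * p)) *
      epowr (Lq_norm q (restr (if k = 0 then dyadic_ball 0 else dyadic_annulus (int k)) f)) p)"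
    by (auto simp: fun_eq_iff inhom_annulus_norm_def)
  finally show ?thesis by (simp add: Herz_norm_def)
qed

text \<open>
  Together with \<open>herz_sum_outer_sum\<close> this shows that the inhomogeneous quasi-norm dominates the homogeneous one.  For \<open>k \<le> 0\<close> the annulus lies in the unit ball,
  whose norm occurs in the sum on the right because that sum runs through index 0.
\<close>
lemma annulus_norm_le_outer_sum:
  assumes "AE x in lebesgue. 0 \<le> q x"
  shows "annulus_norm q f k \<le> outer_sum 0 (inhom_annulus_norm q f) k"
proof -
  have le: "inhom_annulus_norm q f (k + int n) \<le> outer_sum 0 (inhom_annulus_norm q f) k" for n
    unfolding outer_sum_def
    using sum_le_suminf[of "\<lambda>n. inhom_annulus_norm q f (k - 0 + int n)" "{n}"] by simp
  show ?thesis
  proof (cases "0 < k")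
    case True
    with le[of 0] show ?thesis by (simp add: annulus_norm_def inhom_annulus_norm_def)
  next
    case False
    have "annulus_norm q f k \<le> Lq_norm q (restr (dyadic_ball 0) f)"
      unfolding annulus_norm_def using False
      by (intro lux_norm_mono_AE[OF assms] AE_I2) (auto simp: ennorm_restr indicator_def mem_dyadic_ball_iff)
    also have "\<dots> \<le> outer_sum 0 (inhom_annulus_norm q f) k"
      using le[of "nat (- k)"] False by (simp add: inhom_annulus_norm_def)
    finally show ?thesis .
  qed
qed

text \<open>
  Together with \<open>herz_sum_outer_sum\<close> this shows that the inhomogeneous Herz space embeds into the global Lebesgue space: this
  provides the weak bound on the unit ball, which the homogeneous quasi-norm, with its weights tending to 0 at the
  origin, does not control.
\<close>
lemma Lq_norm_le_outer_sum:
  fixes f :: "real^'n \<Rightarrow> 'b::euclidean_space"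
  assumes q: "\<And>x. 1 \<le> q x" and [measurable]: "q \<in> borel_measurable lebesgue" "f \<in> borel_measurable lebesgue"
  shows "Lq_norm q f \<le> outer_sum 0 (inhom_annulus_norm q f) 0"
proof -
  define g where "g n = ennorm (restr (if n = 0 then dyadic_ball 0 else dyadic_annulus (int n)) f)" for n
  have [measurable]: "g n \<in> borel_measurable lebesgue" for n
    unfolding g_def by (cases "n = 0") auto
  have "Lq_norm q f \<le> (\<Sum>n. lux_norm lebesgue q (g n))"
  proof (rule lux_norm_le_suminf)
    show "AE x in lebesgue. \<exists>n. ennorm f x \<le> g n x"
      using AE_lebesgue_nonzero
    proof eventually_elim
      fix x :: "real^'n" assume "x \<noteq> 0"
      then obtain j where j: "x \<in> dyadic_annulus j" by (rule dyadic_annulus_cover)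
      show "\<exists>n. ennorm f x \<le> g n x"
      proof (cases "0 < j")
        case True
        with j show ?thesis by (intro exI[of _ "nat j"]) (auto simp: g_def ennorm_restr)
      next
        case False
        with j show ?thesis by (intro exI[of _ 0]) (auto simp: g_def ennorm_restr mem_dyadic_ball_iff)
      qed
    qed
  qed (use q in auto)
  also have "(\<lambda>n. lux_norm lebesgue q (g n)) = (\<lambda>n. inhom_annulus_norm q f (0 - 0 + int n))"
    by (auto simp: fun_eq_iff g_def inhom_annulus_norm_def)
  finally show ?thesis by (simp add: outer_sum_def)
qed

lemma infsum_nat_le_herz_sum:
  fixes a :: "int \<Rightarrow> ennreal"
  assumes "\<And>k. b (Suc k) = a (int (Suc k))"
  shows "(\<Sum>\<^sub>\<infinity>k::nat. ennreal (2 powr (of_nat k * \<alpha> * p)) * epowr (b k) p) \<le> epowr (b 0) p + herz_sum \<alpha> p a"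
  unfolding infsum_le_iff_ennreal
proof safe
  fix F :: "nat set" assume F: "finite F"
  let ?v = "\<lambda>k. ennreal (2 powr (of_nat k * \<alpha> * p)) * epowr (b k) p"
  let ?u = "\<lambda>k. ennreal (2 powr (of_int k * \<alpha> * p)) * epowr (a k) p"
  have "sum ?v F \<le> sum ?v (insert 0 F)" using F by (intro sum_mono2) auto
  also have "\<dots> = ?v 0 + sum ?v (F - {0})" using F by (simp add: sum.insert_remove)
  also have "sum ?v (F - {0}) = (\<Sum>k\<in>F - {0}. ?u (int k))"
    using assms by (intro sum.cong) (auto simp: gr0_conv_Suc)
  also have "\<dots> = sum ?u (int ` (F - {0}))" by (simp add: sum.reindex)
  also have "\<dots> \<le> herz_sum \<alpha> p a" unfolding herz_sum_def using F by (intro sum_le_infsum_ennreal) auto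
  finally show "sum ?v F \<le> epowr (b 0) p + herz_sum \<alpha> p a" by (simp add: add_left_mono)
qed

text \<open>
  The inhomogeneous space is contained both in the homogeneous one and in the Lebesgue space.  The annuli of positive
  index are handled by the homogeneous estimate, the unit ball by the weak Lebesgue bound.
\<close>
lemma Herz_maps_continuously:
  fixes T :: "(real^'n \<Rightarrow> 'b::{real_normed_field,euclidean_space}) \<Rightarrow> real^'n \<Rightarrow> 'b"
  assumes q: "q \<in> exponents_B" and \<delta>: "is_delta2 q \<delta>"
    and \<alpha>: "0 < \<alpha>" "\<alpha> < real CARD('n) * \<delta>" and p: "0 < p" "p \<le> 1"
    and T: "sublinear_op D T" and size: "size_condition D T"
    and weak: "maps_continuously D T (WLq q) (WLq_norm q) (WLq q) (WLq_norm q)"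
  shows "maps_continuously D T (Herz \<alpha> p q) (Herz_norm \<alpha> p q)
           (weak_Herz \<alpha> p q) (weak_Herz_norm \<alpha> p q)"
proof -
  have qm[measurable]: "q \<in> borel_measurable lebesgue" and q1: "\<And>x. 1 \<le> q x"
    using q by (auto simp: exponents_B_def exponents_P_def)
  have q0: "AE x in lebesgue. 0 \<le> q x" using q1 by (intro AE_I2) (meson zero_le_one order_trans)
  obtain K where K: "0 \<le> K" "hom_Herz \<alpha> p q \<subseteq> D"
    "\<And>f t. f \<in> hom_Herz \<alpha> p q \<Longrightarrow> 0 < t \<Longrightarrow>
      herz_sum \<alpha> p (\<lambda>k. ennreal t * lux_norm lebesgue q (indicator {x \<in> dyadic_annulus k. t < norm (T f x)}))
        \<le> ennreal K * herz_sum \<alpha> p (annulus_norm q f)"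
    using hom_Herz_weak_estimate[OF q \<delta> \<alpha> p T size weak] by blast
  obtain C where C: "0 \<le> C" "WLq q \<subseteq> D" "\<And>f. f \<in> WLq q \<Longrightarrow> WLq_norm q (T f) \<le> ennreal C * WLq_norm q f"
    using weak by (rule maps_continuouslyE) blast
  obtain W where W: "0 \<le> W" "\<And>a. herz_sum \<alpha> p (outer_sum 0 a) \<le> ennreal W * herz_sum \<alpha> p a"
    using herz_sum_outer_sum[OF p \<alpha>(1)] by blast
  define M where "M = C powr p * W + K * W"
  have M: "0 \<le> M" using K(1) C(1) W(1) by (simp add: M_def)
  have hom: "f \<in> hom_Herz \<alpha> p q" and fm: "f \<in> borel_measurable lebesgue"
    and outer: "herz_sum \<alpha> p (outer_sum 0 (inhom_annulus_norm q f)) < top"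
    if f: "f \<in> Herz \<alpha> p q" for f :: "real^'n \<Rightarrow> 'b"
  proof -
    have loc: "f \<in> Lq_loc (- {0}) q" using f by (auto simp: Herz_def Lq_loc_def)
    then show "f \<in> borel_measurable lebesgue" by (rule borel_measurable_Lq_loc_punctured)
    have "herz_sum \<alpha> p (inhom_annulus_norm q f) < top" using f by (simp add: Herz_def Herz_norm_eq)
    then show o: "herz_sum \<alpha> p (outer_sum 0 (inhom_annulus_norm q f)) < top"
      by (intro le_less_trans[OF W(2)]) (auto simp: ennreal_mult_less_top)
    have "herz_sum \<alpha> p (annulus_norm q f) \<le> herz_sum \<alpha> p (outer_sum 0 (inhom_annulus_norm q f))"
      by (rule herz_sum_mono[OF p(1) annulus_norm_le_outer_sum[OF q0]])
    with o have "herz_sum \<alpha> p (annulus_norm q f) < top" by simp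
    then show "f \<in> hom_Herz \<alpha> p q"
      using loc by (simp add: hom_Herz_def hom_Herz_norm_eq)
  qed
  have le: "weak_Herz_norm \<alpha> p q (T f) \<le> ennreal (M powr (1 / p)) * Herz_norm \<alpha> p q f"
    if f: "f \<in> Herz \<alpha> p q" for f
    unfolding weak_Herz_norm_def ennorm_indicat_real Herz_norm_eq
  proof (rule SUP_least)
    fix t :: real assume "t \<in> {0<..}"
    then have t: "0 < t" by simp
    let ?c = "inhom_annulus_norm q f"
    let ?b = "\<lambda>k::nat. lux_norm lebesgue q
      (indicator {x \<in> (if k = 0 then ball 0 1 else dyadic_annulus (int k)). t < norm (T f x)})"
    let ?a = "\<lambda>k. lux_norm lebesgue q (indicator {x \<in> dyadic_annulus k. t < norm (T f x)})"
    have f_norm: "Lq_norm q f \<le> outer_sum 0 ?c 0"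
      by (rule Lq_norm_le_outer_sum[OF q1 qm fm[OF f]])
    have "Lq_norm q f < top"
      by (rule le_less_trans[OF f_norm herz_sum_finite_imp[OF p(1) outer[OF f]]])
    then have fW: "f \<in> WLq q" by (rule Lq_norm_finite_imp_WLq[OF q0 fm[OF f]])
    have "?b 0 \<le> lux_norm lebesgue q (indicator {x. t < norm (T f x)})"
      by (intro lux_norm_mono_AE[OF q0] AE_I2) (auto simp: indicator_def)
    then have "ennreal t * ?b 0 \<le> ennreal t * lux_norm lebesgue q (indicator {x. t < norm (T f x)})"
      by (rule mult_left_mono) simp
    also have "\<dots> \<le> WLq_norm q (T f)" by (rule Lq_norm_superlevel_le_WLq_norm[OF t])
    also have "\<dots> \<le> ennreal C * WLq_norm q f" by (rule C(3)[OF fW])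
    also have "\<dots> \<le> ennreal C * outer_sum 0 ?c 0"
      by (intro mult_left_mono order_trans[OF WLq_norm_le_Lq_norm[OF q0] f_norm]) auto
    finally have "epowr (ennreal t) p * epowr (?b 0) p \<le> epowr (ennreal C) p * epowr (outer_sum 0 ?c 0) p"
      using p epowr_mono[of "ennreal t * ?b 0" "ennreal C * outer_sum 0 ?c 0" p] by (simp add: epowr_mult)
    also have "\<dots> \<le> epowr (ennreal C) p * herz_sum \<alpha> p (outer_sum 0 ?c)"
      using herz_sum_term_le[of 0 \<alpha> p "outer_sum 0 ?c"] by (intro mult_left_mono) auto
    also have "\<dots> \<le> epowr (ennreal C) p * (ennreal W * herz_sum \<alpha> p ?c)"
      by (intro mult_left_mono W(2)) auto
    finally have 0: "epowr (ennreal t) p * epowr (?b 0) p \<le> epowr (ennreal C) p * (ennreal W * herz_sum \<alpha> p ?c)" .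
    have "epowr (ennreal t) p * herz_sum \<alpha> p ?a \<le> ennreal K * herz_sum \<alpha> p (annulus_norm q f)"
      by (rule order_trans[OF epowr_mult_herz_sum_le[OF t p(1)] K(3)[OF hom[OF f] t]])
    also have "\<dots> \<le> ennreal K * herz_sum \<alpha> p (outer_sum 0 ?c)"
      by (intro mult_left_mono herz_sum_mono[OF p(1) annulus_norm_le_outer_sum[OF q0]]) auto
    also have "\<dots> \<le> ennreal K * (ennreal W * herz_sum \<alpha> p ?c)"
      by (intro mult_left_mono W(2)) auto
    finally have 1: "epowr (ennreal t) p * herz_sum \<alpha> p ?a \<le> ennreal K * (ennreal W * herz_sum \<alpha> p ?c)" .
    have "epowr (ennreal t) p * (\<Sum>\<^sub>\<infinity>k. ennreal (2 powr (real k * \<alpha> * p)) * epowr (?b k) p)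
        \<le> epowr (ennreal t) p * (epowr (?b 0) p + herz_sum \<alpha> p ?a)"
      by (intro mult_left_mono infsum_nat_le_herz_sum) auto
    also have "\<dots> \<le> epowr (ennreal C) p * (ennreal W * herz_sum \<alpha> p ?c) + ennreal K * (ennreal W * herz_sum \<alpha> p ?c)"
      unfolding distrib_left by (rule add_mono[OF 0 1])
    also have "\<dots> = ennreal M * herz_sum \<alpha> p ?c"
      using C(1) K(1) W(1) by (simp add: M_def epowr_ennreal ennreal_mult distrib_right mult.assoc)
    finally show "ennreal t * epowr (\<Sum>\<^sub>\<infinity>k. ennreal (2 powr (real k * \<alpha> * p)) * epowr (?b k) p) (1 / p)
      \<le> ennreal (M powr (1 / p)) * epowr (herz_sum \<alpha> p ?c) (1 / p)"
      unfolding mult_epowr_root[OF p(1), of t] by (rule epowr_le_root[OF p(1) M])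
  qed
  have "T f \<in> weak_Herz \<alpha> p q" if f: "f \<in> Herz \<alpha> p q" for f
  proof -
    have "T f \<in> borel_measurable lebesgue" using T hom[OF f] K(2) unfolding sublinear_op_def by blast
    moreover have "weak_Herz_norm \<alpha> p q (T f) < top"
      using f by (intro le_less_trans[OF le[OF f]]) (auto simp: Herz_def ennreal_mult_less_top)
    ultimately show ?thesis by (simp add: weak_Herz_def)
  qed
  with le hom K(2) show ?thesis unfolding maps_continuously_def by blast
qed

theorem theorem3p1:
  fixes q :: "real^'n \<Rightarrow> real"
    and \<delta>\<^sub>2 \<alpha> p :: real
    and D :: "(real^'n \<Rightarrow> 'b::{real_normed_field,euclidean_space}) set"
    and T :: "(real^'n \<Rightarrow> 'b) \<Rightarrow> real^'n \<Rightarrow> 'b"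
  assumes "q \<in> exponents_B"
    and "is_delta2 q \<delta>\<^sub>2"
    and "0 < \<alpha>" and "\<alpha> < real CARD('n) * \<delta>\<^sub>2"
    and "0 < p" and "p \<le> 1"
    and "sublinear_op D T"
    and "maps_continuously D T (WLq q) (WLq_norm q) (WLq q) (WLq_norm q)"
    and "size_condition D T"
  shows "maps_continuously D T (hom_Herz \<alpha> p q) (hom_Herz_norm \<alpha> p q)
           (weak_hom_Herz \<alpha> p q) (weak_hom_Herz_norm \<alpha> p q) \<and>
         maps_continuously D T (Herz \<alpha> p q) (Herz_norm \<alpha> p q)
           (weak_Herz \<alpha> p q) (weak_Herz_norm \<alpha> p q)"
  using hom_Herz_maps_continuously[OF assms(1-7,9,8)] Herz_maps_continuously[OF assms(1-7,9,8)] by blast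

end
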